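(* Let $\rho:\mathbb{R}\to\mathbb{R}_{\ge 0}$ be smooth and strongly convex, i.e. $\inf_x\rho''(x)>0$, let $\delta>1$, and let $F_W$ be a probability distribution on $\mathbb{R}$ with mean zero, finite second moment and well-defined Fisher information $I(F_W)$. Let $(\tau_*,b_* )$ be the unique solution of $$\tau^2=\delta\,\mathbb{E}\{\Psi(W+\tau Z;b)^2\},\qquad \frac1\delta=\mathbb{E}\{\Psi'(W+\tau Z;b)\},$$ where $W\sim F_W$ and $Z\sim\mathsf{N}(0,1)$ are independent. Let $\tilde\Psi(\cdot)=\Psi(\cdot\,;b_* )$ and $\tilde F=F_W\star\mathsf{N}(0,\tau_*^2)$. Then $$V(\tilde\Psi,\tilde F)\ \ge\ \frac{1}{1-1/\delta}\cdot\frac{1}{I(F_W)} .$$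
   Context: Smooth: $\rho$ is continuously differentiable with absolutely continuous derivative $\psi=\rho'$ having an a.e. derivative $\psi'=\rho''$ with $\sup_u\psi'(u)<\infty$. For $b>0$, $\rho_b(z)=\min_{x\in\mathbb{R}}\{b\rho(x)+\frac12(x-z)^2\}$ and $\Psi(z;b)=\rho_b'(z)$; $\Psi'(z;b)$ denotes the derivative in $z$. $V(\psi,F)=(\int\psi^2\,dF)/(\int\psi'\,dF)^2$ is Huber's asymptotic variance functional; $\star$ denotes convolution of distributions. $I(F)=\int (f')^2/f$ is the Fisher information for location of a distribution $F$ with absolutely continuous density $f$. *)

theory Defs
  imports "HOL-Probability.Probability"
begin

definition abs_continuous_on :: "real set \<Rightarrow> (real \<Rightarrow> real) \<Rightarrow> bool" where
  "abs_continuous_on S f \<longleftrightarrow>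
     (\<forall>\<epsilon>>0. \<exists>\<eta>>0. \<forall>I :: (real \<times> real) set.
        finite I \<longrightarrow> (\<forall>(s, t)\<in>I. s \<le> t \<and> {s..t} \<subseteq> S) \<longrightarrow>
        disjoint_family_on (\<lambda>(s, t). {s<..<t}) I \<longrightarrow>
        (\<Sum>(s, t)\<in>I. t - s) < \<eta> \<longrightarrow> (\<Sum>(s, t)\<in>I. \<bar>f t - f s\<bar>) < \<epsilon>)"

(* On the whole line, absolute continuity means absolute continuity on every compact
   interval. The second conjunct follows from the first by Lebesgue's theorem; it records
   that f' exists almost everywhere, so that f' can be written deriv f, whose values at
   the remaining points are irrelevant. *)
definition abs_continuous_ae_deriv :: "(real \<Rightarrow> real) \<Rightarrow> bool" where
  "abs_continuous_ae_deriv f \<longleftrightarrow>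
     (\<forall>s t. abs_continuous_on {s..t} f) \<and> (AE x in lborel. f differentiable (at x))"

(* rho'' is only defined almost everywhere, so its supremum and infimum (below) are
   essential bounds. *)
definition smooth_loss :: "(real \<Rightarrow> real) \<Rightarrow> bool" where
  "smooth_loss \<rho> \<longleftrightarrow>
     (\<forall>x. \<rho> differentiable (at x)) \<and> continuous_on UNIV (deriv \<rho>) \<and>
     abs_continuous_ae_deriv (deriv \<rho>) \<and>
     (\<exists>C. AE u in lborel. deriv (deriv \<rho>) u \<le> C)"

definition strongly_convex_loss :: "(real \<Rightarrow> real) \<Rightarrow> bool" where
  "strongly_convex_loss \<rho> \<longleftrightarrow> (\<exists>c>0. AE u in lborel. c \<le> deriv (deriv \<rho>) u)"

(* For continuous rho \<ge> 0 and b > 0 the objective is continuous, bounded below and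
   coercive, so the infimum is a minimum. *)
definition regularized_loss :: "(real \<Rightarrow> real) \<Rightarrow> real \<Rightarrow> real \<Rightarrow> real" where
  "regularized_loss \<rho> b z = (INF x. b * \<rho> x + (x - z)\<^sup>2 / 2)"

definition effective_score :: "(real \<Rightarrow> real) \<Rightarrow> real \<Rightarrow> real \<Rightarrow> real" where
  "effective_score \<rho> b z = deriv (regularized_loss \<rho> b) z"

definition huber_variance :: "(real \<Rightarrow> real) \<Rightarrow> real measure \<Rightarrow> real" where
  "huber_variance \<psi> F = (LINT x|F. (\<psi> x)\<^sup>2) / (LINT x|F. deriv \<psi> x)\<^sup>2"

definition is_ac_density :: "real measure \<Rightarrow> (real \<Rightarrow> real) \<Rightarrow> bool" where
  "is_ac_density F f \<longleftrightarrow>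
     (\<forall>x. 0 \<le> f x) \<and> abs_continuous_ae_deriv f \<and> F = density lborel (\<lambda>x. ennreal (f x))"

definition has_fisher_information :: "real measure \<Rightarrow> bool" where
  "has_fisher_information F \<longleftrightarrow> (\<exists>f. is_ac_density F f)"

(* A continuous density is unique, so the choice of f is immaterial. The value may be
   infinite. Where f = 0 the integrand is 0, the usual convention (f attains its minimum
   there, so f' = 0 wherever it exists). *)
definition fisher_information :: "real measure \<Rightarrow> ennreal" where
  "fisher_information F =
     (let f = (SOME f. is_ac_density F f) in \<integral>\<^sup>+ x. ennreal ((deriv f x)\<^sup>2 / f x) \<partial>lborel)"

(* N(mu, sigma^2): the second argument is the standard deviation. *)
definition normal_distribution :: "real \<Rightarrow> real \<Rightarrow> real measure" where
  "normal_distribution \<mu> \<sigma> = density lborel (\<lambda>x. ennreal (normal_density \<mu> \<sigma> x))"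

end

theory Submission
  imports Defs
begin

text \<open>
  Write \<open>Y = W + \<tau> Z\<close>, \<open>\<Psi> = effective_score \<rho> b\<close>, \<open>S = f' / f\<close> for the score of the density \<open>f\<close> of
  \<open>W\<close>, and \<open>J = E S(W)\<^sup>2\<close> for its Fisher information.  The two fixed point equations prescribe
  both moments in Huber's functional, so that \<open>V = (\<tau>\<^sup>2 / \<delta>) / (1 / \<delta>)\<^sup>2 = \<delta> \<tau>\<^sup>2\<close>.  Conceptually the bound is
  \<open>V \<ge> 1 / I(F\<^sub>W \<star> N(0, \<tau>\<^sup>2)) \<ge> 1 / J + \<tau>\<^sup>2 = 1 / J + V / \<delta>\<close>, that is, Huber's Cramer-Rao inequality
  followed by Stam's inequality; solving for \<open>V\<close> gives the claim.

  Both inequalities follow from one application of Cauchy-Schwarz, which avoids the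
  Fisher information of the convolution.  Integration by parts in \<open>W\<close> and in \<open>Z\<close>
  separately gives \<open>E \<Psi>(Y) S(W) = - E \<Psi>'(Y)\<close> and \<open>E \<Psi>(Y) Z = \<tau> E \<Psi>'(Y)\<close>.  The variable
  \<open>u = J \<tau> Z - S(W)\<close> therefore satisfies \<open>E \<Psi>(Y) u = (1 + J \<tau>\<^sup>2) E \<Psi>'(Y)\<close>, while independence gives
  \<open>E u\<^sup>2 = J (1 + J \<tau>\<^sup>2)\<close>.  Hence \<open>(1 + J \<tau>\<^sup>2) (E \<Psi>'(Y))\<^sup>2 \<le> J E \<Psi>(Y)\<^sup>2\<close>
  (lemma \<open>gaussian_convolution_information_bound\<close>).  With the prescribed moments this reads
  \<open>1 + J \<tau>\<^sup>2 \<le> \<delta> J \<tau>\<^sup>2 = J V\<close>, which is the claim and shows in particular that \<open>J > 0\<close>.  If \<open>J\<close> is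
  infinite, the lower bound is \<open>0\<close>.

  The remaining work is to justify these computations.  The density \<open>f\<close> and the derivative of \<open>\<rho>\<close> are
  only absolutely continuous, so the fundamental theorem of calculus is needed for such
  functions; a gauge argument gives it (\<open>fundamental_theorem_abs_continuous\<close>).
  Applied to \<open>f\<close> times a nonexpansive function it yields the integration by parts
  (\<open>score_integration_by_parts\<close>).  Applied to the derivative of \<open>\<rho>\<close> it shows that
  \<open>x \<mapsto> b \<rho>'(x) + x\<close> is Lipschitz and expanding; \<open>\<Psi>(z)\<close> is \<open>z\<close> minus the inverse of this map
  at \<open>z\<close>, so \<open>\<Psi>\<close> is nonexpansive and differentiable almost everywhere
  (\<open>effective_score_regularity\<close>).
\<close>

section \<open>Absolutely continuous functions\<close>

text \<open>
  In a fine tagged division the increments over intervals tagged outside \<open>N\<close> are approximated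
  by the Riemann summands, as in the classical theorem.  The intervals tagged in \<open>N\<close> have small total length, because they lie in
  an open set of small measure, so absolute continuity makes the sum of their increments small.
\<close>

lemma fundamental_theorem_abs_continuous:
  fixes f f' :: "real \<Rightarrow> real"
  assumes ab: "a \<le> b" and ac: "abs_continuous_on {a..b} f" and N: "negligible N"
    and D: "\<And>x. x \<in> {a..b} - N \<Longrightarrow> (f has_real_derivative f' x) (at x)"
  shows "(f' has_integral (f b - f a)) {a..b}"
proof -
  define f0 where "f0 x = (if x \<in> N then 0 else f' x)" for x
  have "(f0 has_integral (f b - f a)) {a..b}"
    unfolding has_integral_real
  proof (intro allI impI)
    fix e :: real assume e: "e > 0"
    define e1 where "e1 = e / (2 * (b - a + 1))"
    have e1: "e1 > 0" "e1 * (b - a) < e / 2"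
    proof -
      show "e1 > 0" using e ab by (simp add: e1_def)
      have "e * (b - a) < e * (b - a + 1)" using e by simp
      then show "e1 * (b - a) < e / 2" using ab by (simp add: e1_def field_simps)
    qed
    from ac[unfolded abs_continuous_on_def, rule_format, of "e / 2"] e
    obtain \<eta> where \<eta>: "\<eta> > 0" and ac': "\<forall>I. finite I \<longrightarrow> (\<forall>(s, t)\<in>I. s \<le> t \<and> {s..t} \<subseteq> {a..b}) \<longrightarrow>
        disjoint_family_on (\<lambda>(s, t). {s<..<t}) I \<longrightarrow>
        (\<Sum>(s, t)\<in>I. t - s) < \<eta> \<longrightarrow> (\<Sum>(s, t)\<in>I. \<bar>f t - f s\<bar>) < e / 2"
      by auto
    obtain U where U: "open U" "N \<subseteq> U" "emeasure lborel U < ennreal \<eta>"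
    proof -
      have Nn: "N \<in> null_sets lebesgue" using N by (simp add: negligible_iff_null_sets)
      obtain T where T: "open T" "N \<subseteq> T" "T - N \<in> lmeasurable" "emeasure lebesgue (T - N) < ennreal \<eta>"
        using sets_lebesgue_outer_open[of N \<eta>] Nn \<eta> by blast
      have "emeasure lebesgue (T - N) = emeasure lebesgue T"
        using T(1) Nn by (intro emeasure_Diff_null_set) auto
      then show thesis using T that[of T] by simp
    qed
    have "\<exists>d>0. x \<in> {a..b} - N \<longrightarrow> (\<forall>y. \<bar>y - x\<bar> < d \<longrightarrow> \<bar>f y - f x - f' x * (y - x)\<bar> \<le> e1 * \<bar>y - x\<bar>)" for x
    proof (cases "x \<in> {a..b} - N")
      case True
      then show ?thesis using D[OF True] e1(1)
        unfolding has_field_derivative_def has_derivative_at_alt by (auto simp: mult.commute)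
    qed (auto intro: exI[of _ 1])
    then obtain d where d: "\<And>x. d x > 0" "\<And>x y. x \<in> {a..b} - N \<Longrightarrow> \<bar>y - x\<bar> < d x \<Longrightarrow> \<bar>f y - f x - f' x * (y - x)\<bar> \<le> e1 * \<bar>y - x\<bar>"
      by metis
    \<comment> \<open>Tags in the exceptional set get intervals inside the small open set \<open>U\<close>; at the other tags
      the increment of \<open>f\<close> is close to its linear approximation.\<close>
    define \<gamma> where "\<gamma> x = (if x \<in> N then U else ball x (d x))" for x
    have gauge: "gauge \<gamma>" using U d(1) by (auto simp: gauge_def \<gamma>_def)
    have close: "norm ((\<Sum>(x, K)\<in>p. measure lborel K *\<^sub>R f0 x) - (f b - f a)) < e"
      if p: "p tagged_division_of {a..b}" and fine: "\<gamma> fine p" for p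
    proof -
      note finp = tagged_division_of_finite[OF p]
      have K: "K = {Inf K..Sup K}" "Inf K \<le> x" "x \<le> Sup K" "a \<le> Inf K" "Sup K \<le> b"
          "measure lborel K = Sup K - Inf K" "K \<subseteq> \<gamma> x" if xK: "(x, K) \<in> p" for x K
      proof -
        obtain u v where uv: "K = {u..v}" using tagged_division_ofD(4)[OF p xK] by auto
        have x: "x \<in> K" "K \<subseteq> {a..b}" using tagged_division_ofD(2,3)[OF p xK] by auto
        then have "u \<le> v" using uv by auto
        then show "K = {Inf K..Sup K}" "Inf K \<le> x" "x \<le> Sup K" "a \<le> Inf K" "Sup K \<le> b"
          "measure lborel K = Sup K - Inf K" using uv x by auto
        show "K \<subseteq> \<gamma> x" using fine xK by (auto simp: fine_def)
      qed
      \<comment> \<open>The pieces controlled by absolute continuity.  Degenerate pieces are dropped because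
        they may repeat, and \<open>(x, K) \<mapsto> (Inf K, Sup K)\<close> must be injective.\<close>
      define q where "q = {(x, K) \<in> p. x \<in> N \<and> Inf K < Sup K}"
      have qp: "q \<subseteq> p" by (auto simp: q_def)
      have finq: "finite q" using finp qp finite_subset by blast
      define I where "I = (\<lambda>(x, K). (Inf K, Sup K)) ` q"
      have disj: "(x1, K1) = (x2, K2)" if "(x1, K1) \<in> q" "(x2, K2) \<in> q"
          "{Inf K1<..<Sup K1} \<inter> {Inf K2<..<Sup K2} \<noteq> {}" for x1 K1 x2 K2
      proof (rule ccontr)
        assume ne: "(x1, K1) \<noteq> (x2, K2)"
        have in_p: "(x1, K1) \<in> p" "(x2, K2) \<in> p" using that qp by auto
        have "interior K1 \<inter> interior K2 = {}" using tagged_division_ofD(5)[OF p in_p ne] .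
        moreover have "interior K1 = {Inf K1<..<Sup K1}" "interior K2 = {Inf K2<..<Sup K2}"
          using K(1)[OF in_p(1)] K(1)[OF in_p(2)] by (metis interior_atLeastAtMost_real)+
        ultimately show False using that(3) by simp
      qed
      have inj: "inj_on (\<lambda>(x, K). (Inf K, Sup K)) q"
      proof (rule inj_onI, clarify)
        fix x1 K1 x2 K2 assume q12: "(x1, K1) \<in> q" "(x2, K2) \<in> q" and eq: "Inf K1 = Inf K2" "Sup K1 = Sup K2"
        have "Inf K1 < Sup K1" using q12 by (auto simp: q_def)
        then have "{Inf K1<..<Sup K1} \<inter> {Inf K2<..<Sup K2} \<noteq> {}" using eq by simp
        from disj[OF q12 this] show "x1 = x2 \<and> K1 = K2" by simp
      qed
      have dI: "disjoint_family_on (\<lambda>(s, t). {s<..<t}) I"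
        unfolding disjoint_family_on_def I_def using disj by fastforce
      have "(\<Sum>(s, t)\<in>I. \<bar>f t - f s\<bar>) < e / 2"
      proof (rule ac'[THEN spec, THEN mp, THEN mp, THEN mp, THEN mp])
        show "finite I" using finq by (simp add: I_def)
        show "\<forall>(s, t)\<in>I. s \<le> t \<and> {s..t} \<subseteq> {a..b}"
        proof (clarsimp simp: I_def)
          fix x K assume "(x, K) \<in> q"
          then have "(x, K) \<in> p" using qp by auto
          from K(2-5)[OF this] show "Inf K \<le> Sup K \<and> (Inf K \<le> Sup K \<longrightarrow> a \<le> Inf K \<and> Sup K \<le> b)" by simp
        qed
        show "disjoint_family_on (\<lambda>(s, t). {s<..<t}) I" by (fact dI)
        have le: "s \<le> t" if "(s, t) \<in> I" for s t using that by (auto simp: I_def q_def)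
        have sub: "{s<..<t} \<subseteq> U" if st: "(s, t) \<in> I" for s t
        proof -
          obtain x K where xK: "(x, K) \<in> q" "s = Inf K" "t = Sup K" using st by (auto simp: I_def)
          then have "K \<subseteq> U" using K(7)[of x K] by (auto simp: q_def \<gamma>_def)
          moreover have "K = {s..t}" using K(1)[of x K] xK qp by auto
          ultimately show ?thesis by auto
        qed
        have nonneg: "0 \<le> (\<Sum>(s, t)\<in>I. t - s)" using le by (intro sum_nonneg) auto
        have "ennreal (\<Sum>(s, t)\<in>I. t - s) = (\<Sum>(s, t)\<in>I. ennreal (t - s))"
          using le by (subst sum_ennreal[symmetric]) (auto intro!: sum.cong simp: case_prod_beta)
        also have "\<dots> = (\<Sum>i\<in>I. emeasure lborel ((\<lambda>(s, t). {s<..<t}) i))"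
          using le by (intro sum.cong) auto
        also have "\<dots> = emeasure lborel (\<Union>i\<in>I. (\<lambda>(s, t). {s<..<t}) i)"
          using dI \<open>finite I\<close> by (intro sum_emeasure) auto
        also have "\<dots> \<le> emeasure lborel U"
          using sub U(1) by (intro emeasure_mono) auto
        also have "\<dots> < ennreal \<eta>" by (fact U(3))
        finally show "(\<Sum>(s, t)\<in>I. t - s) < \<eta>"
          using nonneg by (simp only: ennreal_less_iff)
      qed
      also have "(\<Sum>(s, t)\<in>I. \<bar>f t - f s\<bar>) = (\<Sum>(x, K)\<in>q. \<bar>f (Sup K) - f (Inf K)\<bar>)"
        unfolding I_def by (subst sum.reindex[OF inj]) (auto intro!: sum.cong)
      finally have bad: "(\<Sum>(x, K)\<in>q. \<bar>f (Sup K) - f (Inf K)\<bar>) < e / 2" .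
      have tbound: "\<bar>measure lborel K *\<^sub>R f0 x - (f (Sup K) - f (Inf K))\<bar>
          \<le> e1 * measure lborel K + (if (x, K) \<in> q then \<bar>f (Sup K) - f (Inf K)\<bar> else 0)"
        if xK: "(x, K) \<in> p" for x K
      proof (cases "x \<in> N")
        case True
        note k = K[OF xK]
        show ?thesis
        proof (cases "Inf K < Sup K")
          case True
          have "0 \<le> e1 * measure lborel K" using e1(1) by simp
          then show ?thesis using True \<open>x \<in> N\<close> xK by (simp add: q_def f0_def)
        next
          case False
          then have "Inf K = Sup K" using k by linarith
          then show ?thesis using \<open>x \<in> N\<close> xK e1(1) by (simp add: q_def f0_def)
        qed
      next
        case False
        note k = K[OF xK]
        have x: "x \<in> {a..b} - N" using k False by auto
        have "Inf K \<in> K" "Sup K \<in> K" using k(1-3) by (metis atLeastAtMost_iff order.refl order.trans)+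
        then have "Inf K \<in> ball x (d x)" "Sup K \<in> ball x (d x)" using k(7) False by (auto simp: \<gamma>_def)
        then have near: "\<bar>Inf K - x\<bar> < d x" "\<bar>Sup K - x\<bar> < d x" by (auto simp: dist_real_def)
        have *: "\<bar>f (Inf K) - f x - f' x * (Inf K - x)\<bar> \<le> e1 * (x - Inf K)"
             "\<bar>f (Sup K) - f x - f' x * (Sup K - x)\<bar> \<le> e1 * (Sup K - x)"
          using d(2)[OF x near(1)] d(2)[OF x near(2)] k by auto
        have "measure lborel K *\<^sub>R f0 x - (f (Sup K) - f (Inf K)) =
           (f (Inf K) - f x - f' x * (Inf K - x)) - (f (Sup K) - f x - f' x * (Sup K - x))"
          unfolding k(6) using False by (simp add: f0_def algebra_simps)
        moreover have "e1 * measure lborel K = e1 * (x - Inf K) + e1 * (Sup K - x)"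
          unfolding k(6) by (simp add: algebra_simps)
        ultimately have "\<bar>measure lborel K *\<^sub>R f0 x - (f (Sup K) - f (Inf K))\<bar> \<le> e1 * measure lborel K"
          using * by linarith
        then show ?thesis by auto
      qed
      have "f b - f a = (\<Sum>(x, K)\<in>p. f (Sup K) - f (Inf K))"
        using additive_tagged_division_1[OF ab p, of f] by simp
      then have "norm ((\<Sum>(x, K)\<in>p. measure lborel K *\<^sub>R f0 x) - (f b - f a))
          = \<bar>\<Sum>(x, K)\<in>p. measure lborel K *\<^sub>R f0 x - (f (Sup K) - f (Inf K))\<bar>"
        by (simp add: sum_subtractf case_prod_beta)
      also have "\<dots> \<le> (\<Sum>(x, K)\<in>p. \<bar>measure lborel K *\<^sub>R f0 x - (f (Sup K) - f (Inf K))\<bar>)"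
        by (rule order.trans[OF sum_abs]) (simp add: case_prod_beta)
      also have "\<dots> \<le> (\<Sum>(x, K)\<in>p. e1 * measure lborel K + (if (x, K) \<in> q then \<bar>f (Sup K) - f (Inf K)\<bar> else 0))"
        using tbound by (intro sum_mono) auto
      also have "\<dots> = e1 * (\<Sum>(x, K)\<in>p. measure lborel K) + (\<Sum>(x, K)\<in>p. if (x, K) \<in> q then \<bar>f (Sup K) - f (Inf K)\<bar> else 0)"
        by (simp add: sum.distrib case_prod_beta sum_distrib_left)
      also have "(\<Sum>(x, K)\<in>p. if (x, K) \<in> q then \<bar>f (Sup K) - f (Inf K)\<bar> else 0) = (\<Sum>(x, K)\<in>q. \<bar>f (Sup K) - f (Inf K)\<bar>)"
        using finp qp by (intro sum.mono_neutral_cong_right) (auto split: prod.splits)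
      also have "(\<Sum>(x, K)\<in>p. measure lborel K) = b - a"
        using additive_content_tagged_division[of p a b] p ab by simp
      finally show ?thesis using bad e1(2) by linarith
    qed
    show "\<exists>\<gamma>. gauge \<gamma> \<and> (\<forall>\<D>. \<D> tagged_division_of {a..b} \<and> \<gamma> fine \<D> \<longrightarrow>
       norm ((\<Sum>(x, K)\<in>\<D>. measure lborel K *\<^sub>R f0 x) - (f b - f a)) < e)"
      using gauge close by (intro exI[of _ \<gamma>] conjI allI impI) simp_all
  qed
  then show ?thesis
    by (rule has_integral_spike[OF N, rotated]) (simp add: f0_def)
qed

lemma fundamental_theorem_abs_continuous_AE:
  assumes "a \<le> b" "abs_continuous_on {a..b} f"
    and AE: "AE x in lborel. (f has_real_derivative f' x) (at x)"
  shows "(f' has_integral (f b - f a)) {a..b}"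
proof -
  have "AE x in lebesgue. (f has_real_derivative f' x) (at x)"
    using AE by (rule AE_completion)
  then obtain N where "N \<in> null_sets lebesgue" "{x. \<not> (f has_real_derivative f' x) (at x)} \<subseteq> N"
    unfolding eventually_ae_filter by auto
  then show ?thesis
    using assms(1,2) by (intro fundamental_theorem_abs_continuous[of a b f N])
      (auto simp: negligible_iff_null_sets)
qed

lemma abs_continuous_on_Lipschitz:
  assumes L: "\<And>x y. x \<in> S \<Longrightarrow> y \<in> S \<Longrightarrow> \<bar>f y - f x\<bar> \<le> L * \<bar>y - x\<bar>"
  shows "abs_continuous_on S f"
  unfolding abs_continuous_on_def
proof (intro allI impI)
  fix \<epsilon> :: real assume \<epsilon>: "\<epsilon> > 0"
  define \<eta> where "\<eta> = \<epsilon> / (\<bar>L\<bar> + 1)"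
  have "\<eta> > 0" using \<epsilon> by (simp add: \<eta>_def)
  moreover have "(\<Sum>(s, t)\<in>I. \<bar>f t - f s\<bar>) < \<epsilon>"
    if I: "\<forall>(s, t)\<in>I. s \<le> t \<and> {s..t} \<subseteq> S" and small: "(\<Sum>(s, t)\<in>I. t - s) < \<eta>" for I :: "(real \<times> real) set"
  proof -
    have "(\<Sum>(s, t)\<in>I. \<bar>f t - f s\<bar>) \<le> (\<Sum>(s, t)\<in>I. (\<bar>L\<bar> + 1) * (t - s))"
    proof (rule sum_mono, clarify)
      fix s t assume st: "(s, t) \<in> I"
      then have "s \<le> t" "s \<in> S" "t \<in> S" using I by fastforce+
      then have "\<bar>f t - f s\<bar> \<le> L * (t - s)" using L[of s t] by simp
      also have "\<dots> \<le> (\<bar>L\<bar> + 1) * (t - s)" using \<open>s \<le> t\<close> by (intro mult_right_mono) auto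
      finally show "\<bar>f t - f s\<bar> \<le> (\<bar>L\<bar> + 1) * (t - s)" .
    qed
    also have "\<dots> = (\<bar>L\<bar> + 1) * (\<Sum>(s, t)\<in>I. t - s)"
      by (simp add: sum_distrib_left case_prod_beta)
    also have "\<dots> < (\<bar>L\<bar> + 1) * \<eta>" using small by (intro mult_strict_left_mono) auto
    also have "\<dots> = \<epsilon>" by (simp add: \<eta>_def)
    finally show ?thesis .
  qed
  ultimately show "\<exists>\<eta>>0. \<forall>I. finite I \<longrightarrow> (\<forall>(s, t)\<in>I. s \<le> t \<and> {s..t} \<subseteq> S) \<longrightarrow>
      disjoint_family_on (\<lambda>(s, t). {s<..<t}) I \<longrightarrow> (\<Sum>(s, t)\<in>I. t - s) < \<eta> \<longrightarrow>
      (\<Sum>(s, t)\<in>I. \<bar>f t - f s\<bar>) < \<epsilon>"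
    by (intro exI[of _ \<eta>]) simp
qed

lemma abs_continuous_on_imp_continuous_on:
  assumes ac: "abs_continuous_on {a..b} f"
  shows "continuous_on {a..b} f"
  unfolding continuous_on_iff
proof (intro ballI allI impI)
  fix x \<epsilon> :: real assume x: "x \<in> {a..b}" and \<epsilon>: "\<epsilon> > 0"
  from ac[unfolded abs_continuous_on_def, rule_format, OF \<epsilon>]
  obtain \<eta> where \<eta>: "\<eta> > 0" and ac': "\<forall>I. finite I \<longrightarrow> (\<forall>(s, t)\<in>I. s \<le> t \<and> {s..t} \<subseteq> {a..b}) \<longrightarrow>
        disjoint_family_on (\<lambda>(s, t). {s<..<t}) I \<longrightarrow>
        (\<Sum>(s, t)\<in>I. t - s) < \<eta> \<longrightarrow> (\<Sum>(s, t)\<in>I. \<bar>f t - f s\<bar>) < \<epsilon>"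
    by auto
  have step: "\<bar>f v - f u\<bar> < \<epsilon>" if "a \<le> u" "u \<le> v" "v \<le> b" "v - u < \<eta>" for u v
    using ac'[rule_format, of "{(u, v)}"] that by (auto simp: disjoint_family_on_def)
  show "\<exists>d>0. \<forall>y\<in>{a..b}. dist y x < d \<longrightarrow> dist (f y) (f x) < \<epsilon>"
  proof (intro exI[of _ \<eta>] conjI ballI impI)
    fix y assume y: "y \<in> {a..b}" "dist y x < \<eta>"
    then show "dist (f y) (f x) < \<epsilon>"
      using step[of x y] step[of y x] x by (cases "x \<le> y") (auto simp: dist_real_def)
  qed (fact \<eta>)
qed

lemma abs_continuous_on_mult:
  assumes f: "abs_continuous_on {a..b} f" and g: "abs_continuous_on {a..b} g"
  shows "abs_continuous_on {a..b} (\<lambda>x. f x * g x)"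
proof -
  have "bounded (f ` {a..b})" "bounded (g ` {a..b})"
    using f g by (auto intro!: compact_imp_bounded compact_continuous_image
        dest: abs_continuous_on_imp_continuous_on)
  then obtain A B where A: "A > 0" "\<And>x. x \<in> {a..b} \<Longrightarrow> \<bar>f x\<bar> \<le> A"
    and B: "B > 0" "\<And>x. x \<in> {a..b} \<Longrightarrow> \<bar>g x\<bar> \<le> B"
    unfolding bounded_pos by auto
  show ?thesis unfolding abs_continuous_on_def
  proof (intro allI impI)
    fix \<epsilon> :: real assume \<epsilon>: "\<epsilon> > 0"
    have \<epsilon>': "\<epsilon> / (2 * B) > 0" "\<epsilon> / (2 * A) > 0" using \<epsilon> A B by auto
    from f[unfolded abs_continuous_on_def, rule_format, OF \<epsilon>'(1)]
    obtain \<eta>1 where \<eta>1: "\<eta>1 > 0" and f': "\<forall>I. finite I \<longrightarrow> (\<forall>(s, t)\<in>I. s \<le> t \<and> {s..t} \<subseteq> {a..b}) \<longrightarrow>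
        disjoint_family_on (\<lambda>(s, t). {s<..<t}) I \<longrightarrow>
        (\<Sum>(s, t)\<in>I. t - s) < \<eta>1 \<longrightarrow> (\<Sum>(s, t)\<in>I. \<bar>f t - f s\<bar>) < \<epsilon> / (2 * B)"
      by auto
    from g[unfolded abs_continuous_on_def, rule_format, OF \<epsilon>'(2)]
    obtain \<eta>2 where \<eta>2: "\<eta>2 > 0" and g': "\<forall>I. finite I \<longrightarrow> (\<forall>(s, t)\<in>I. s \<le> t \<and> {s..t} \<subseteq> {a..b}) \<longrightarrow>
        disjoint_family_on (\<lambda>(s, t). {s<..<t}) I \<longrightarrow>
        (\<Sum>(s, t)\<in>I. t - s) < \<eta>2 \<longrightarrow> (\<Sum>(s, t)\<in>I. \<bar>g t - g s\<bar>) < \<epsilon> / (2 * A)"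
      by auto
    have "(\<Sum>(s, t)\<in>I. \<bar>f t * g t - f s * g s\<bar>) < \<epsilon>"
      if I: "finite I" "\<forall>(s, t)\<in>I. s \<le> t \<and> {s..t} \<subseteq> {a..b}"
        "disjoint_family_on (\<lambda>(s, t). {s<..<t}) I" "(\<Sum>(s, t)\<in>I. t - s) < min \<eta>1 \<eta>2"
      for I :: "(real \<times> real) set"
    proof -
      have "(\<Sum>(s, t)\<in>I. \<bar>f t * g t - f s * g s\<bar>)
          \<le> (\<Sum>(s, t)\<in>I. B * \<bar>f t - f s\<bar> + A * \<bar>g t - g s\<bar>)"
      proof (rule sum_mono, clarify)
        fix s t assume st: "(s, t) \<in> I"
        then have *: "s \<in> {a..b}" "t \<in> {a..b}" using I(2) by fastforce+
        have "f t * g t - f s * g s = g t * (f t - f s) + f s * (g t - g s)" by (simp add: algebra_simps)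
        then have "\<bar>f t * g t - f s * g s\<bar> \<le> \<bar>g t\<bar> * \<bar>f t - f s\<bar> + \<bar>f s\<bar> * \<bar>g t - g s\<bar>"
          by (metis abs_mult abs_triangle_ineq)
        also have "\<dots> \<le> B * \<bar>f t - f s\<bar> + A * \<bar>g t - g s\<bar>"
          using * A(2) B(2) by (intro add_mono mult_right_mono) auto
        finally show "\<bar>f t * g t - f s * g s\<bar> \<le> B * \<bar>f t - f s\<bar> + A * \<bar>g t - g s\<bar>" .
      qed
      also have "\<dots> = B * (\<Sum>(s, t)\<in>I. \<bar>f t - f s\<bar>) + A * (\<Sum>(s, t)\<in>I. \<bar>g t - g s\<bar>)"
        by (simp add: sum.distrib sum_distrib_left case_prod_beta)
      also have "\<dots> < B * (\<epsilon> / (2 * B)) + A * (\<epsilon> / (2 * A))"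
        using A(1) B(1) I f'[THEN spec, THEN mp, THEN mp, THEN mp, THEN mp, of I]
           g'[THEN spec, THEN mp, THEN mp, THEN mp, THEN mp, of I]
        by (intro add_strict_mono mult_strict_left_mono) simp_all
      also have "\<dots> = \<epsilon>" using A(1) B(1) by simp
      finally show ?thesis .
    qed
    then show "\<exists>\<eta>>0. \<forall>I. finite I \<longrightarrow> (\<forall>(s, t)\<in>I. s \<le> t \<and> {s..t} \<subseteq> {a..b}) \<longrightarrow>
      disjoint_family_on (\<lambda>(s, t). {s<..<t}) I \<longrightarrow> (\<Sum>(s, t)\<in>I. t - s) < \<eta> \<longrightarrow>
      (\<Sum>(s, t)\<in>I. \<bar>f t * g t - f s * g s\<bar>) < \<epsilon>"
      using \<eta>1 \<eta>2 by (intro exI[of _ "min \<eta>1 \<eta>2"]) simp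
  qed
qed

text \<open>
  Integrating \<open>h(x + 1) - h(x)\<close> over \<open>x\<close> gives \<open>0\<close> by translation invariance.  The difference is also
  the integral of \<open>h'\<close> over \<open>[x, x + 1]\<close>, and by Fubini every \<open>h'(t)\<close> is counted over a set of \<open>x\<close> of
  length one.  This avoids discussing the limits of \<open>h\<close> at infinity.
\<close>

lemma integral_derivative_eq_0:
  fixes h h' :: "real \<Rightarrow> real"
  assumes ac: "\<forall>s t. abs_continuous_on {s..t} h"
    and D: "AE x in lborel. (h has_real_derivative h' x) (at x)"
    and h: "integrable lborel h" and h': "integrable lborel h'"
  shows "(\<integral>x. h' x \<partial>lborel) = 0"
proof -
  have [measurable]: "h' \<in> borel_measurable borel" using h' by auto
  \<comment> \<open>The integrand of \<open>\<integral> (\<integral>\<^bsub>x\<^esub>\<^bsup>x+1\<^esup> h'(t) dt) dx\<close>, to be integrated in both orders.\<close>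
  define k where "k = (\<lambda>(x, t). indicat_real {x..x + 1} t * h' t)"
  have k_meas [measurable]: "k \<in> borel_measurable (lborel \<Otimes>\<^sub>M lborel)"
  proof -
    have "k = (\<lambda>z. if fst z \<le> snd z \<and> snd z \<le> fst z + 1 then h' (snd z) else 0)"
      by (auto simp: k_def fun_eq_iff indicator_def)
    then show ?thesis by simp
  qed
  have swap: "indicat_real {x..x + 1} t = indicator {t - 1..t} x" for x t :: real
    by (auto simp: indicator_def)
  have k_int: "integrable (lborel \<Otimes>\<^sub>M lborel) k"
  proof -
    have "integrable (lborel \<Otimes>\<^sub>M lborel) (\<lambda>(t, x). k (x, t))"
    proof (rule lborel_pair.Fubini_integrable)
      have "(\<lambda>t. \<integral>x. norm (case (t, x) of (t, x) \<Rightarrow> k (x, t)) \<partial>lborel) = (\<lambda>t. \<bar>h' t\<bar>)"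
        by (simp add: k_def swap abs_mult)
      then show "integrable lborel (\<lambda>t. \<integral>x. norm (case (t, x) of (t, x) \<Rightarrow> k (x, t)) \<partial>lborel)"
        using h' by simp
      show "AE t in lborel. integrable lborel (\<lambda>x. case (t, x) of (t, x) \<Rightarrow> k (x, t))"
        by (auto simp: k_def swap intro!: integrable_mult_left integrable_real_indicator)
    qed measurable
    then show ?thesis using lborel_pair.integrable_product_swap_iff[of k] by simp
  qed
  have inner: "(\<integral>t. k (x, t) \<partial>lborel) = h (x + 1) - h x" for x
  proof -
    have "(h' has_integral (h (x + 1) - h x)) {x..x + 1}"
      using ac D by (intro fundamental_theorem_abs_continuous_AE) auto
    moreover have "set_integrable lborel {x..x + 1} h'"
      using h' unfolding set_integrable_def by (intro integrable_mult_indicator) auto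
    ultimately have "(LINT t : {x..x + 1} | lborel. h' t) = h (x + 1) - h x"
      by (metis integral_unique set_borel_integral_eq_integral(2))
    then show ?thesis by (simp add: k_def set_lebesgue_integral_def)
  qed
  have shift: "integrable lborel (\<lambda>x. h (x + 1))" "(\<integral>x. h (x + 1) \<partial>lborel) = (\<integral>x. h x \<partial>lborel)"
    using lborel_integrable_real_affine[OF h, of 1 1] lborel_integral_real_affine[of 1 h 1]
    by (simp_all add: add.commute)
  have "(\<integral>t. h' t \<partial>lborel) = (\<integral>t. (\<integral>x. k (x, t) \<partial>lborel) \<partial>lborel)"
    by (simp add: k_def swap)
  also have "\<dots> = (\<integral>x. (\<integral>t. k (x, t) \<partial>lborel) \<partial>lborel)"
    using lborel_pair.Fubini_integral[of "\<lambda>x t. k (x, t)"] k_int by simp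
  also have "\<dots> = (\<integral>x. h (x + 1) - h x \<partial>lborel)" by (simp add: inner)
  also have "\<dots> = 0" using shift h by simp
  finally show ?thesis .
qed

section \<open>Measurability of derivatives and the Cauchy-Schwarz inequality\<close>

text \<open>
  Differentiability at a point is a closed condition on the increment \<open>h\<close>, so for continuous \<open>f\<close>
  it suffices to test it for rational \<open>h\<close>; the set of points of differentiability is then Borel.
  Borel rather than Lebesgue measurability is needed to push integrals forward to the law of a random variable.
\<close>

lemma borel_measurable_deriv:
  fixes f :: "real \<Rightarrow> real"
  assumes cont: "continuous_on UNIV f"
  shows "deriv f \<in> borel_measurable borel"
proof -
  have [measurable]: "f \<in> borel_measurable borel"
    by (rule borel_measurable_continuous_onI[OF cont])
  \<comment> \<open>\<open>L\<close> is the only candidate for the derivative; \<open>D\<close> tests it on rational increments.\<close>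
  define L where "L x = lim (\<lambda>n. (f (x + 1 / Suc n) - f x) / (1 / Suc n))" for x
  have [measurable]: "L \<in> borel_measurable borel" unfolding L_def by measurable
  define D where "D x \<longleftrightarrow> (\<forall>n::nat. \<exists>m::nat. \<forall>h\<in>\<rat>. \<bar>h\<bar> < 1 / Suc m \<longrightarrow>
      \<bar>f (x + h) - f x - L x * h\<bar> \<le> 1 / Suc n * \<bar>h\<bar>)" for x
  have [measurable]: "Measurable.pred borel D"
    unfolding D_def using countable_rat by measurable
  have D_deriv: "D x" if x: "(f has_real_derivative l) (at x)" for x l
  proof -
    have "((\<lambda>h. (f (x + h) - f x) / h) \<longlongrightarrow> l) (at 0)"
      using x by (simp add: DERIV_def)
    moreover have "filterlim (\<lambda>n. 1 / real (Suc n)) (at 0) sequentially"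
      by (rule filterlim_atI[OF LIMSEQ_Suc[OF lim_1_over_n]]) auto
    ultimately have "(\<lambda>n. (f (x + 1 / Suc n) - f x) / (1 / Suc n)) \<longlonglongrightarrow> l"
      by (rule filterlim_compose)
    then have "L x = l" unfolding L_def by (rule limI)
    then have alt: "\<forall>e>0. \<exists>d>0. \<forall>y. \<bar>y - x\<bar> < d \<longrightarrow> \<bar>f y - f x - L x * (y - x)\<bar> \<le> e * \<bar>y - x\<bar>"
      using x unfolding has_field_derivative_def has_derivative_at_alt by simp
    show "D x" unfolding D_def
    proof
      fix n :: nat
      obtain d where d: "d > 0" "\<And>y. \<bar>y - x\<bar> < d \<Longrightarrow> \<bar>f y - f x - L x * (y - x)\<bar> \<le> 1 / Suc n * \<bar>y - x\<bar>"
        using alt by (metis of_nat_0_less_iff zero_less_Suc zero_less_divide_1_iff)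
      obtain m where "1 / real (Suc m) < d" using d(1) nat_approx_posE by blast
      then show "\<exists>m::nat. \<forall>h\<in>\<rat>. \<bar>h\<bar> < 1 / Suc m \<longrightarrow> \<bar>f (x + h) - f x - L x * h\<bar> \<le> 1 / Suc n * \<bar>h\<bar>"
        using d(2)[of "x + h" for h] by (intro exI[of _ m]) auto
    qed
  qed
  have deriv_D: "(f has_real_derivative L x) (at x)" if "D x" for x
    unfolding has_field_derivative_def has_derivative_at_alt
  proof (intro conjI allI impI)
    show "bounded_linear ((*) (L x))" by (rule bounded_linear_mult_right)
    fix e :: real assume "e > 0"
    then obtain n where n: "1 / real (Suc n) < e" using nat_approx_posE by blast
    obtain m where m: "\<And>h. h \<in> \<rat> \<Longrightarrow> \<bar>h\<bar> < 1 / Suc m \<Longrightarrow> \<bar>f (x + h) - f x - L x * h\<bar> \<le> 1 / Suc n * \<bar>h\<bar>"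
      using \<open>D x\<close> unfolding D_def by blast
    let ?C = "{h. \<bar>f (x + h) - f x - L x * h\<bar> \<le> 1 / Suc n * \<bar>h\<bar>}"
    have "closed ?C"
      by (intro closed_Collect_le continuous_intros continuous_on_compose2[OF cont]) auto
    moreover have "{- (1 / Suc m)<..<1 / Suc m} \<inter> \<rat> \<subseteq> ?C" using m by auto
    ultimately have "closure ({- (1 / real (Suc m))<..<1 / Suc m} \<inter> \<rat>) \<subseteq> ?C"
      by (intro closure_minimal)
    moreover have "closure ({- (1 / real (Suc m))<..<1 / Suc m} \<inter> \<rat>) = closure {- (1 / real (Suc m))<..<1 / Suc m}"
      by (rule closure_open_Int_superset) (auto simp: Rats_closure_real)
    ultimately have C: "\<bar>h\<bar> < 1 / Suc m \<Longrightarrow> h \<in> ?C" for h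
      using closure_subset[of "{- (1 / real (Suc m))<..<1 / Suc m}"] by (auto simp: abs_less_iff)
    show "\<exists>d>0. \<forall>y. norm (y - x) < d \<longrightarrow> norm (f y - f x - L x * (y - x)) \<le> e * norm (y - x)"
    proof (intro exI[of _ "1 / real (Suc m)"] conjI allI impI)
      fix y assume "norm (y - x) < 1 / real (Suc m)"
      then have "\<bar>f y - f x - L x * (y - x)\<bar> \<le> 1 / Suc n * \<bar>y - x\<bar>"
        using C[of "y - x"] by simp
      also have "\<dots> \<le> e * \<bar>y - x\<bar>" using n by (intro mult_right_mono) auto
      finally show "norm (f y - f x - L x * (y - x)) \<le> e * norm (y - x)" by simp
    qed simp
  qed
  \<comment> \<open>Where \<open>f\<close> has no derivative, \<^const>\<open>deriv\<close> chooses from an empty predicate, so it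
    takes the same value at all these points.\<close>
  have "deriv f x = (if D x then L x else (SOME l. False))" for x
  proof (cases "D x")
    case True
    then show ?thesis using DERIV_imp_deriv[OF deriv_D] by simp
  next
    case False
    then have "(\<lambda>l. (f has_real_derivative l) (at x)) = (\<lambda>l. False)" using D_deriv by blast
    then show ?thesis using False by (simp add: deriv_def)
  qed
  then have "deriv f = (\<lambda>x. if D x then L x else (SOME l. False))" by auto
  then show ?thesis by simp
qed

lemma nonexpansive_continuous:
  fixes \<Psi> :: "real \<Rightarrow> real"
  assumes "\<And>x y. \<bar>\<Psi> y - \<Psi> x\<bar> \<le> \<bar>y - x\<bar>"
  shows "continuous_on UNIV \<Psi>"
proof -
  have "1-lipschitz_on UNIV \<Psi>"
    using assms by (intro lipschitz_onI) (auto simp: dist_real_def)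
  then show ?thesis by (rule lipschitz_on_continuous_on)
qed

lemma integrable_mult_of_squares:
  fixes u v :: "'a \<Rightarrow> real"
  assumes [measurable]: "u \<in> borel_measurable M" "v \<in> borel_measurable M"
    and sq: "integrable M (\<lambda>x. (u x)\<^sup>2)" "integrable M (\<lambda>x. (v x)\<^sup>2)"
  shows "integrable M (\<lambda>x. u x * v x)"
proof (rule Bochner_Integration.integrable_bound)
  show "integrable M (\<lambda>x. (u x)\<^sup>2 + (v x)\<^sup>2)" using sq by simp
  have "\<bar>u x * v x\<bar> \<le> (u x)\<^sup>2 + (v x)\<^sup>2" for x
  proof -
    have "0 \<le> (\<bar>u x\<bar> - \<bar>v x\<bar>)\<^sup>2" by simp
    then have "2 * (\<bar>u x\<bar> * \<bar>v x\<bar>) \<le> (u x)\<^sup>2 + (v x)\<^sup>2" by (simp add: power2_diff)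
    then show ?thesis by (simp add: abs_mult) (metis abs_ge_zero mult_nonneg_nonneg order.trans le_add_same_cancel1 mult_2)
  qed
  then show "AE x in M. norm (u x * v x) \<le> norm ((u x)\<^sup>2 + (v x)\<^sup>2)" by simp
qed measurable

lemma Cauchy_Schwarz_integral:
  fixes u v :: "'a \<Rightarrow> real"
  assumes [measurable]: "u \<in> borel_measurable M" "v \<in> borel_measurable M"
    and sq: "integrable M (\<lambda>x. (u x)\<^sup>2)" "integrable M (\<lambda>x. (v x)\<^sup>2)"
  shows "(LINT x|M. u x * v x)\<^sup>2 \<le> (LINT x|M. (u x)\<^sup>2) * (LINT x|M. (v x)\<^sup>2)"
proof -
  define A B C where ABC: "A = (LINT x|M. (u x)\<^sup>2)" "B = (LINT x|M. u x * v x)" "C = (LINT x|M. (v x)\<^sup>2)"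
  note uv = integrable_mult_of_squares[OF assms]
  have quad: "0 \<le> A - 2 * t * B + t\<^sup>2 * C" for t
  proof -
    have "0 \<le> (LINT x|M. (u x - t * v x)\<^sup>2)" by simp
    also have "(\<lambda>x. (u x - t * v x)\<^sup>2) = (\<lambda>x. (u x)\<^sup>2 - 2 * t * (u x * v x) + t\<^sup>2 * (v x)\<^sup>2)"
      by (simp add: fun_eq_iff power2_eq_square algebra_simps)
    also have "(LINT x|M. (u x)\<^sup>2 - 2 * t * (u x * v x) + t\<^sup>2 * (v x)\<^sup>2) = A - 2 * t * B + t\<^sup>2 * C"
      using sq uv by (simp add: ABC)
    finally show ?thesis .
  qed
  have "C \<ge> 0" by (simp add: ABC)
  have "B\<^sup>2 \<le> A * C"
  proof (cases "C = 0")
    case True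
    \<comment> \<open>If \<open>B \<noteq> 0\<close>, the affine function \<open>A - 2 t B\<close> would be \<open>-1\<close> at this \<open>t\<close>.\<close>
    then have "B = 0" using quad[of "(A + 1) / (2 * B)"] by (cases "B = 0") auto
    then show ?thesis using True by simp
  next
    case False
    then show ?thesis using quad[of "B / C"] \<open>C \<ge> 0\<close>
      by (simp add: power2_eq_square field_simps)
  qed
  then show ?thesis by (simp add: ABC)
qed

section \<open>Regularity of the effective score\<close>

text \<open>
  By absolute continuity an increment of \<open>\<rho>'\<close> is the integral of \<open>\<rho>''\<close>, so the essential bounds on
  \<open>\<rho>''\<close> become bounds on the difference quotients of \<open>\<rho>'\<close>.
\<close>

lemma deriv_loss_increments:
  assumes smooth: "smooth_loss \<rho>" and conv: "strongly_convex_loss \<rho>"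
  obtains C where "C \<ge> 0" "\<And>x y. x \<le> y \<Longrightarrow> 0 \<le> deriv \<rho> y - deriv \<rho> x"
    "\<And>x y. x \<le> y \<Longrightarrow> deriv \<rho> y - deriv \<rho> x \<le> C * (y - x)"
proof -
  obtain C where C: "AE u in lborel. deriv (deriv \<rho>) u \<le> C" using smooth by (auto simp: smooth_loss_def)
  obtain c where c: "c > 0" "AE u in lborel. c \<le> deriv (deriv \<rho>) u"
    using conv by (auto simp: strongly_convex_loss_def)
  have ac: "\<forall>s t. abs_continuous_on {s..t} (deriv \<rho>)" "AE x in lborel. deriv \<rho> differentiable (at x)"
    using smooth by (auto simp: smooth_loss_def abs_continuous_ae_deriv_def)
  \<comment> \<open>A version of \<open>\<rho>''\<close> that obeys the essential bounds at every point.\<close>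
  define d where "d x = max 0 (min (max 0 C) (deriv (deriv \<rho>) x))" for x
  have "AE x in lborel. (deriv \<rho> has_real_derivative d x) (at x)"
    using C c(2) ac(2)
  proof eventually_elim
    case (elim x)
    then have "d x = deriv (deriv \<rho>) x" using c(1) by (simp add: d_def)
    then show ?case using elim(3) by (simp add: DERIV_deriv_iff_real_differentiable)
  qed
  then have int: "(d has_integral (deriv \<rho> y - deriv \<rho> x)) {x..y}" if "x \<le> y" for x y
    using that ac(1) by (intro fundamental_theorem_abs_continuous_AE) auto
  show thesis
  proof (rule that[of "max 0 C"])
    fix x y :: real assume xy: "x \<le> y"
    show "0 \<le> deriv \<rho> y - deriv \<rho> x"
      using int[OF xy] by (rule has_integral_nonneg) (simp add: d_def)
    show "deriv \<rho> y - deriv \<rho> x \<le> max 0 C * (y - x)"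
      using int[OF xy] has_integral_const_real[of "max 0 C" x y] xy
      by (rule_tac has_integral_le[of d _ "{x..y}" "\<lambda>x. max 0 C"]) (auto simp: d_def mult.commute)
  qed simp
qed

text \<open>
  The envelope theorem.  The equation for \<open>p z\<close> is the stationarity condition of the convex
  objective, so \<open>p z\<close> attains the minimum.  Comparing the minimal values at two points, each time with
  the minimizer of the other problem as competitor, traps the difference quotient of the
  envelope between two expressions that tend to \<open>z - p z\<close>.
\<close>

lemma effective_score_prox:
  fixes \<rho> :: "real \<Rightarrow> real" and p :: "real \<Rightarrow> real"
  assumes diff: "\<And>x. \<rho> differentiable (at x)" and mono: "\<And>x y. x \<le> y \<Longrightarrow> deriv \<rho> x \<le> deriv \<rho> y"
    and b: "b > 0" and p: "\<And>z. b * deriv \<rho> (p z) + p z = z" and cont: "continuous_on UNIV p"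
  shows "effective_score \<rho> b z = z - p z"
proof -
  have min: "b * \<rho> (p z) + (p z - z)\<^sup>2 / 2 \<le> b * \<rho> x + (x - z)\<^sup>2 / 2" for x z
  proof -
    let ?h = "\<lambda>x. b * \<rho> x + (x - z)\<^sup>2 / 2" and ?h' = "\<lambda>x. b * deriv \<rho> x + x - z"
    have D: "(?h has_real_derivative ?h' x) (at x)" for x
      using diff[of x] unfolding DERIV_deriv_iff_real_differentiable[symmetric]
      by (auto intro!: derivative_eq_intros)
    have m: "b * deriv \<rho> x \<le> b * deriv \<rho> y" if "x \<le> y" for x y
      using mono[OF that] b by simp
    show ?thesis
    proof (cases "x \<le> p z")
      case True
      show ?thesis
      proof (rule DERIV_nonpos_imp_nonincreasing[OF True])
        fix y assume "x \<le> y" "y \<le> p z"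
        then show "\<exists>l. (?h has_real_derivative l) (at y) \<and> l \<le> 0"
          using D[of y] m[of y "p z"] p[of z] by (intro exI[of _ "?h' y"] conjI) linarith+
      qed
    next
      case False
      then have le: "p z \<le> x" by simp
      show ?thesis
      proof (rule DERIV_nonneg_imp_nondecreasing[OF le])
        fix y assume "p z \<le> y" "y \<le> x"
        then show "\<exists>l. (?h has_real_derivative l) (at y) \<and> 0 \<le> l"
          using D[of y] m[of "p z" y] p[of z] by (intro exI[of _ "?h' y"] conjI) linarith+
      qed
    qed
  qed
  define r where "r = regularized_loss \<rho> b"
  have r: "r z = b * \<rho> (p z) + (p z - z)\<^sup>2 / 2" for z
    unfolding r_def regularized_loss_def by (rule cInf_eq_minimum) (auto intro: min)
  \<comment> \<open>The minimizer for \<open>z\<close> is a competitor in the problem for \<open>y\<close>.\<close>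
  have upper: "r y - r z \<le> (y - z) * ((y + z) / 2 - p z)" for y z
    using min[of y "p z"] unfolding r by (simp add: power2_eq_square algebra_simps add_divide_distrib diff_divide_distrib)
  have bound: "\<bar>r y - r z - (y - z) * (z - p z)\<bar> \<le> \<bar>y - z\<bar> * (\<bar>y - z\<bar> + \<bar>p y - p z\<bar>)" for y
  proof -
    have "r y - r z - (y - z) * (z - p z) \<le> (y - z) * ((y - z) / 2)"
      using upper[of y z] by (simp add: algebra_simps add_divide_distrib diff_divide_distrib)
    moreover have "r y - r z - (y - z) * (z - p z) \<ge> (y - z) * ((y - z) / 2 - (p y - p z))"
      using upper[of z y] by (simp add: algebra_simps add_divide_distrib diff_divide_distrib)
    moreover have "(y - z) * ((y - z) / 2) \<le> \<bar>y - z\<bar> * (\<bar>y - z\<bar> + \<bar>p y - p z\<bar>)"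
      by (rule order.trans[OF abs_ge_self], unfold abs_mult, rule mult_left_mono) auto
    moreover have "\<bar>(y - z) / 2\<bar> \<le> \<bar>y - z\<bar>" by simp
    then have "\<bar>(y - z) / 2 - (p y - p z)\<bar> \<le> \<bar>y - z\<bar> + \<bar>p y - p z\<bar>"
      using abs_triangle_ineq4[of "(y - z) / 2" "p y - p z"] by linarith
    then have "\<bar>y - z\<bar> * \<bar>(y - z) / 2 - (p y - p z)\<bar> \<le> \<bar>y - z\<bar> * (\<bar>y - z\<bar> + \<bar>p y - p z\<bar>)"
      by (rule mult_left_mono) simp
    then have "- ((y - z) * ((y - z) / 2 - (p y - p z))) \<le> \<bar>y - z\<bar> * (\<bar>y - z\<bar> + \<bar>p y - p z\<bar>)"
      using abs_ge_minus_self[of "(y - z) * ((y - z) / 2 - (p y - p z))"] unfolding abs_mult by linarith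
    ultimately show ?thesis by linarith
  qed
  have "(r has_real_derivative (z - p z)) (at z)"
    unfolding has_field_derivative_def has_derivative_at_alt
  proof (intro conjI allI impI)
    show "bounded_linear ((*) (z - p z))" by (rule bounded_linear_mult_right)
    fix e :: real assume e: "e > 0"
    have "isCont p z" using cont by (simp add: continuous_on_eq_continuous_at)
    then obtain d where d: "d > 0" "\<And>y. \<bar>y - z\<bar> < d \<Longrightarrow> \<bar>p y - p z\<bar> < e / 2"
      using e unfolding continuous_at_eps_delta by (metis dist_real_def half_gt_zero)
    show "\<exists>d>0. \<forall>y. norm (y - z) < d \<longrightarrow> norm (r y - r z - (z - p z) * (y - z)) \<le> e * norm (y - z)"
    proof (intro exI[of _ "min d (e / 2)"] conjI allI impI)
      fix y assume "norm (y - z) < min d (e / 2)"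
      then have "\<bar>y - z\<bar> + \<bar>p y - p z\<bar> \<le> e" using d(2)[of y] by auto
      then have "\<bar>y - z\<bar> * (\<bar>y - z\<bar> + \<bar>p y - p z\<bar>) \<le> \<bar>y - z\<bar> * e" by (rule mult_left_mono) simp
      then show "norm (r y - r z - (z - p z) * (y - z)) \<le> e * norm (y - z)"
        using bound[of y] by (simp add: mult.commute)
    qed (use d e in auto)
  qed
  then show ?thesis unfolding effective_score_def r_def by (rule DERIV_imp_deriv)
qed

text \<open>
  The map \<open>g(x) = b \<rho>'(x) + x\<close> is Lipschitz and satisfies \<open>g(y) - g(x) \<ge> y - x\<close> for \<open>x \<le> y\<close>.  Its inverse
  is therefore increasing and nonexpansive, and so is the identity minus the inverse, which is the
  effective score.  Being Lipschitz, \<open>g\<close> maps null sets to null sets, and this transports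
  almost everywhere differentiability from \<open>g\<close> to its inverse.
\<close>

lemma effective_score_regularity:
  assumes smooth: "smooth_loss \<rho>" and conv: "strongly_convex_loss \<rho>" and b: "b > 0"
  shows "\<bar>effective_score \<rho> b y - effective_score \<rho> b x\<bar> \<le> \<bar>y - x\<bar>"
    and "AE x in lborel. effective_score \<rho> b differentiable (at x)"
proof -
  obtain C where C: "C \<ge> 0" "\<And>x y. x \<le> y \<Longrightarrow> 0 \<le> deriv \<rho> y - deriv \<rho> x"
    "\<And>x y. x \<le> y \<Longrightarrow> deriv \<rho> y - deriv \<rho> x \<le> C * (y - x)"
    using deriv_loss_increments[OF smooth conv] by blast
  define g where "g x = b * deriv \<rho> x + x" for x
  have g_lower: "y - x \<le> g y - g x" if "x \<le> y" for x y
  proof -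
    have "0 \<le> b * (deriv \<rho> y - deriv \<rho> x)" using C(2)[OF that] b by simp
    then show ?thesis by (simp add: g_def algebra_simps)
  qed
  have g_upper: "g y - g x \<le> (b * C + 1) * (y - x)" if "x \<le> y" for x y
  proof -
    have "b * (deriv \<rho> y - deriv \<rho> x) \<le> b * (C * (y - x))" using C(3)[OF that] b by simp
    then show ?thesis by (simp add: g_def algebra_simps)
  qed
  have g_Lip: "\<bar>g y - g x\<bar> \<le> (b * C + 1) * \<bar>y - x\<bar>" for x y
    using g_upper[of x y] g_upper[of y x] g_lower[of x y] g_lower[of y x] by (cases "x \<le> y") auto
  have g_cont: "continuous_on UNIV g"
    using smooth unfolding g_def smooth_loss_def by (intro continuous_intros) auto
  have "\<exists>x. g x = z" for z
  proof -
    define r where "r = \<bar>z - g 0\<bar>"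
    have "g (- r) \<le> z" "z \<le> g r" using g_lower[of "- r" 0] g_lower[of 0 r] by (auto simp: r_def)
    then show ?thesis
      using IVT'[of g "- r" z r] continuous_on_subset[OF g_cont] by (auto simp: r_def)
  qed
  \<comment> \<open>\<open>p\<close> is the proximal map of \<open>b \<rho>\<close>.\<close>
  then obtain p where p: "\<And>z. g (p z) = z" by metis
  have p_mono: "0 \<le> p z' - p z \<and> p z' - p z \<le> z' - z" if "z \<le> z'" for z z'
    using g_lower[of "p z" "p z'"] g_lower[of "p z'" "p z"] p[of z] p[of z'] that
    by (cases "p z \<le> p z'") auto
  have p_cont: "continuous_on UNIV p"
  proof (rule nonexpansive_continuous)
    fix z z' show "\<bar>p z' - p z\<bar> \<le> \<bar>z' - z\<bar>"
      using p_mono[of z z'] p_mono[of z' z] by (cases "z \<le> z'") auto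
  qed
  have score: "effective_score \<rho> b = (\<lambda>z. z - p z)"
  proof
    fix z show "effective_score \<rho> b z = z - p z"
    proof (rule effective_score_prox)
      show "\<rho> differentiable at x" for x using smooth by (simp add: smooth_loss_def)
      show "deriv \<rho> x \<le> deriv \<rho> y" if "x \<le> y" for x y using C(2)[OF that] by simp
    qed (use b p p_cont in \<open>auto simp: g_def\<close>)
  qed
  show "\<bar>effective_score \<rho> b y - effective_score \<rho> b x\<bar> \<le> \<bar>y - x\<bar>"
    using p_mono[of x y] p_mono[of y x] unfolding score by (cases "x \<le> y") auto
  have "AE x in lebesgue. deriv \<rho> differentiable (at x)"
    using smooth by (intro AE_completion) (simp add: smooth_loss_def abs_continuous_ae_deriv_def)
  then obtain N where N: "N \<in> null_sets lebesgue" "{x. \<not> deriv \<rho> differentiable (at x)} \<subseteq> N"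
    unfolding eventually_ae_filter by auto
  \<comment> \<open>The inverse \<open>p\<close> can fail to be differentiable only on the image under \<open>g\<close> of the points where \<open>g\<close> fails.\<close>
  have "negligible (g ` N)"
  proof (rule negligible_locally_Lipschitz_image)
    fix x
    show "\<exists>T B. open T \<and> x \<in> T \<and> (\<forall>y\<in>N \<inter> T. norm (g y - g x) \<le> B * norm (y - x))"
      using g_Lip by (intro exI[of _ UNIV] exI[of _ "b * C + 1"]) auto
  qed (use N in \<open>auto simp: negligible_iff_null_sets\<close>)
  then have "AE z in lebesgue. z \<notin> g ` N"
    by (intro AE_not_in) (simp add: negligible_iff_null_sets)
  then have "AE z in lborel. z \<notin> g ` N" by (simp add: AE_completion_iff)
  then show "AE z in lborel. effective_score \<rho> b differentiable (at z)"
  proof eventually_elim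
    case (elim z)
    then have "p z \<notin> N" using p[of z] by (metis imageI)
    then have "deriv \<rho> differentiable at (p z)" using N(2) by blast
    then have "(deriv \<rho> has_real_derivative deriv (deriv \<rho>) (p z)) (at (p z))"
      by (simp add: DERIV_deriv_iff_real_differentiable)
    then have Dg: "(g has_real_derivative b * deriv (deriv \<rho>) (p z) + 1) (at (p z))" (is "(_ has_real_derivative ?D) _")
      unfolding g_def by (auto intro!: derivative_eq_intros)
    have "?D \<ge> 1"
    proof -
      have "((\<lambda>h. (g (p z + h) - g (p z)) / h) \<longlongrightarrow> ?D) (at 0)" using Dg by (simp add: DERIV_def)
      moreover have "1 \<le> (g (p z + h) - g (p z)) / h" if "h \<noteq> 0" for h
        using g_lower[of "p z" "p z + h"] g_lower[of "p z + h" "p z"] that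
        by (cases "h > 0") (auto simp: le_divide_eq field_simps)
      ultimately show ?thesis
        by (intro tendsto_lowerbound[of _ ?D "at 0"]) (auto simp: eventually_at_filter)
    qed
    then have "(p has_real_derivative inverse ?D) (at z)"
      using Dg p p_cont
      by (intro has_field_derivative_inverse_basic[where f = g and t = UNIV])
        (auto simp: continuous_on_eq_continuous_at)
    then have "((\<lambda>z. z - p z) has_real_derivative (1 - inverse ?D)) (at z)"
      by (auto intro!: derivative_eq_intros)
    then show ?case unfolding score using real_differentiable_def by blast
  qed
qed

section \<open>Integration by parts against a density\<close>

text \<open>
  The absolutely continuous function \<open>f g\<close> has derivative \<open>f (g s + g')\<close>, whose integral vanishes.
  Here \<open>s\<close> is the score of \<open>f\<close>, given through \<open>f' = s f\<close>.  This form needs no division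
  where \<open>f\<close> vanishes and covers the normal density, with \<open>s(x) = - x\<close>, as well.
\<close>

lemma score_integration_by_parts:
  fixes f g g' s :: "real \<Rightarrow> real"
  assumes f_nonneg: "\<And>x. 0 \<le> f x"
    and f_ac: "\<forall>u v. abs_continuous_on {u..v} f"
    and f_deriv: "AE x in lborel. (f has_real_derivative s x * f x) (at x)"
    and g_ac: "\<forall>u v. abs_continuous_on {u..v} g"
    and g_deriv: "AE x in lborel. (g has_real_derivative g' x) (at x)"
    and [measurable]: "f \<in> borel_measurable borel" "s \<in> borel_measurable borel" 
       "g \<in> borel_measurable borel" "g' \<in> borel_measurable borel"
    and F: "F = density lborel (\<lambda>x. ennreal (f x))"
    and int: "integrable F g" "integrable F (\<lambda>x. g x * s x)" "integrable F g'"
  shows "(LINT x|F. g x * s x) = - (LINT x|F. g' x)"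
proof -
  have trans: "integrable F u \<longleftrightarrow> integrable lborel (\<lambda>x. f x * u x)" 
      "(LINT x|F. u x) = (\<integral>x. f x * u x \<partial>lborel)"
    if "u \<in> borel_measurable borel" for u :: "real \<Rightarrow> real"
    using that f_nonneg unfolding F
    by (simp_all add: integrable_real_density integral_real_density)
  have I: "integrable lborel (\<lambda>x. f x * g x)" "integrable lborel (\<lambda>x. f x * (g x * s x))"
      "integrable lborel (\<lambda>x. f x * g' x)"
    using int by (simp_all add: trans)
  have "(\<integral>x. f x * (g x * s x) + f x * g' x \<partial>lborel) = 0"
  proof (rule integral_derivative_eq_0[of "\<lambda>x. f x * g x"])
    show "\<forall>u v. abs_continuous_on {u..v} (\<lambda>x. f x * g x)"
      using f_ac g_ac abs_continuous_on_mult by blast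
    show "AE x in lborel. ((\<lambda>x. f x * g x) has_real_derivative f x * (g x * s x) + f x * g' x) (at x)"
      using f_deriv g_deriv
      by eventually_elim (auto intro!: derivative_eq_intros simp: algebra_simps)
    show "integrable lborel (\<lambda>x. f x * g x)" by (rule I)
    show "integrable lborel (\<lambda>x. f x * (g x * s x) + f x * g' x)" using I by simp
  qed
  then show ?thesis using I by (simp add: trans)
qed

text \<open>
  At a zero of \<open>f\<close> where \<open>f\<close> is differentiable, \<open>f\<close> has a minimum and hence derivative \<open>0\<close>.  Thus
  \<open>f' / f\<close>, with value \<open>0\<close> for a vanishing denominator, satisfies \<open>f' = (f' / f) f\<close> almost
  everywhere.  The Fisher information is the second moment of this score.
\<close>

lemma is_ac_density_score:
  assumes "is_ac_density F f"
  shows "\<forall>u v. abs_continuous_on {u..v} f" 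
    and "f \<in> borel_measurable borel" "(\<lambda>x. deriv f x / f x) \<in> borel_measurable borel"
    and "AE x in lborel. (f has_real_derivative (deriv f x / f x) * f x) (at x)"
    and "(\<integral>\<^sup>+ x. ennreal ((deriv f x)\<^sup>2 / f x) \<partial>lborel) = (\<integral>\<^sup>+ x. ennreal ((deriv f x / f x)\<^sup>2) \<partial>F)"
proof -
  have f: "\<And>x. 0 \<le> f x" "\<forall>u v. abs_continuous_on {u..v} f"
      "AE x in lborel. f differentiable (at x)" "F = density lborel (\<lambda>x. ennreal (f x))"
    using assms by (auto simp: is_ac_density_def abs_continuous_ae_deriv_def)
  show "\<forall>u v. abs_continuous_on {u..v} f" by fact
  have "continuous_on UNIV f"
    unfolding continuous_on_eq_continuous_at[OF open_UNIV]
  proof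
    fix x :: real
    have "continuous_on {x - 1..x + 1} f" using f(2) by (auto intro: abs_continuous_on_imp_continuous_on)
    then have "continuous_on {x - 1<..<x + 1} f" by (rule continuous_on_subset) auto
    then show "isCont f x" by (subst (asm) continuous_on_eq_continuous_at) auto
  qed
  then have [measurable]: "f \<in> borel_measurable borel" "deriv f \<in> borel_measurable borel"
    by (auto intro: borel_measurable_continuous_onI borel_measurable_deriv)
  show "f \<in> borel_measurable borel" "(\<lambda>x. deriv f x / f x) \<in> borel_measurable borel" by measurable
  show "AE x in lborel. (f has_real_derivative (deriv f x / f x) * f x) (at x)"
    using f(3)
  proof eventually_elim
    case (elim x)
    then have D: "(f has_real_derivative deriv f x) (at x)" by (simp add: DERIV_deriv_iff_real_differentiable)
    show ?case
    proof (cases "f x = 0")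
      case True
      then have "deriv f x = 0" using DERIV_local_min[OF D, of 1] f(1) by simp
      then show ?thesis using D by simp
    qed (use D in simp)
  qed
  have "f x * (deriv f x / f x)\<^sup>2 = (deriv f x)\<^sup>2 / f x" for x
    by (simp add: power2_eq_square)
  then show "(\<integral>\<^sup>+ x. ennreal ((deriv f x)\<^sup>2 / f x) \<partial>lborel) = (\<integral>\<^sup>+ x. ennreal ((deriv f x / f x)\<^sup>2) \<partial>F)"
    unfolding f(4) using f(1) by (subst nn_integral_density) (simp_all add: ennreal_mult'[symmetric])
qed

lemma std_normal_density_score:
  "(std_normal_density has_real_derivative (- x) * std_normal_density x) (at x)"
  unfolding normal_density_def by (auto intro!: derivative_eq_intros simp: field_simps power2_eq_square)

lemma abs_continuous_std_normal_density: "abs_continuous_on S std_normal_density"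
proof (rule abs_continuous_on_Lipschitz)
  fix x y :: real
  have bound: "\<bar>- x * std_normal_density x\<bar> \<le> 1" for x :: real
  proof -
    have "\<bar>x\<bar> \<le> 1 + x\<^sup>2 / 2" using zero_le_power2[of "\<bar>x\<bar> - 1"] by (simp add: power2_diff)
    also have "\<dots> \<le> exp (x\<^sup>2 / 2)" by (rule exp_ge_add_one_self)
    finally have "\<bar>x\<bar> * exp (- (x\<^sup>2 / 2)) \<le> 1" by (simp add: exp_minus field_simps)
    moreover have "1 / sqrt (2 * pi) \<le> 1" using pi_gt3 by (simp add: divide_le_eq)
    ultimately have "(1 / sqrt (2 * pi)) * (\<bar>x\<bar> * exp (- (x\<^sup>2 / 2))) \<le> 1 * 1"
      by (intro mult_mono) auto
    then show ?thesis by (simp add: normal_density_def abs_mult)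
  qed
  have "norm (std_normal_density y - std_normal_density x) \<le> 1 * norm (y - x)"
    using std_normal_density_score bound
    by (intro field_differentiable_bound[where S = UNIV and f' = "\<lambda>x. - x * std_normal_density x"])
      (auto intro: has_field_derivative_at_within)
  then show "\<bar>std_normal_density y - std_normal_density x\<bar> \<le> 1 * \<bar>y - x\<bar>" by simp
qed

lemma AE_lborel_real_affine:
  fixes c t :: real
  assumes "AE x in lborel. P x" "c \<noteq> 0"
  shows "AE x in lborel. P (t + c * x)"
proof -
  have "AE x in density (distr lborel borel (\<lambda>x. t + c * x)) (\<lambda>_. ennreal \<bar>c\<bar>). P x"
    using assms(1) by (subst (asm) lborel_real_affine[OF assms(2), of t]) 
  then have "AE x in distr lborel borel (\<lambda>x. t + c * x). P x"
    using assms(2) by (subst (asm) AE_density) auto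
  then show ?thesis by (rule AE_distrD[rotated]) simp
qed

text \<open>
  By independence one may fix the value of \<open>X\<close> and integrate by parts in \<open>Y\<close> alone.  The inner
  integrability conditions hold for almost every value of \<open>X\<close> by Fubini.
\<close>

lemma (in prob_space) expectation_score_identity:
  fixes f s \<Psi> :: "real \<Rightarrow> real" and X Y :: "'a \<Rightarrow> real" and k c :: real
  assumes f_nonneg: "\<And>x. 0 \<le> f x"
    and f_ac: "\<forall>u v. abs_continuous_on {u..v} f"
    and f_deriv: "AE x in lborel. (f has_real_derivative s x * f x) (at x)"
    and [measurable]: "f \<in> borel_measurable borel" "s \<in> borel_measurable borel" 
    and Psi_Lip: "\<And>x y. \<bar>\<Psi> y - \<Psi> x\<bar> \<le> \<bar>y - x\<bar>"
    and Psi_diff: "AE x in lborel. \<Psi> differentiable (at x)"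
    and ind: "indep_var borel X borel Y"
    and Y: "distr M borel Y = density lborel (\<lambda>x. ennreal (f x))"
    and c: "c \<noteq> 0"
    and int: "integrable M (\<lambda>\<omega>. \<Psi> (k * X \<omega> + c * Y \<omega>))"
       "integrable M (\<lambda>\<omega>. \<Psi> (k * X \<omega> + c * Y \<omega>) * s (Y \<omega>))"
       "integrable M (\<lambda>\<omega>. deriv \<Psi> (k * X \<omega> + c * Y \<omega>))"
  shows "expectation (\<lambda>\<omega>. \<Psi> (k * X \<omega> + c * Y \<omega>) * s (Y \<omega>))
       = - c * expectation (\<lambda>\<omega>. deriv \<Psi> (k * X \<omega> + c * Y \<omega>))"
proof -
  have rv [measurable]: "X \<in> borel_measurable M" "Y \<in> borel_measurable M"
    using indep_var_rv1[OF ind] indep_var_rv2[OF ind] by auto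
  have Psi_cont: "continuous_on UNIV \<Psi>" by (rule nonexpansive_continuous[OF Psi_Lip])
  have [measurable]: "\<Psi> \<in> borel_measurable borel" "deriv \<Psi> \<in> borel_measurable borel"
    using Psi_cont by (auto intro: borel_measurable_continuous_onI borel_measurable_deriv)
  define G where "G = distr M borel X"
  define F where "F = distr M borel Y"
  interpret G: prob_space G unfolding G_def by (rule prob_space_distr) simp
  interpret F: prob_space F unfolding F_def by (rule prob_space_distr) simp
  interpret GF: pair_sigma_finite G F ..
  have sets [measurable_cong]: "sets G = sets borel" "sets F = sets borel" by (simp_all add: G_def F_def)
  have joint: "G \<Otimes>\<^sub>M F = distr M (borel \<Otimes>\<^sub>M borel) (\<lambda>\<omega>. (X \<omega>, Y \<omega>))"
    using ind unfolding indep_var_distribution_eq G_def F_def by simp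
  have trans: "integrable (G \<Otimes>\<^sub>M F) u \<longleftrightarrow> integrable M (\<lambda>\<omega>. u (X \<omega>, Y \<omega>))"
      "(LINT z|(G \<Otimes>\<^sub>M F). u z) = expectation (\<lambda>\<omega>. u (X \<omega>, Y \<omega>))"
    if "u \<in> borel_measurable (borel \<Otimes>\<^sub>M borel)" for u :: "real \<times> real \<Rightarrow> real"
    using that unfolding joint by (simp_all add: integrable_distr_eq integral_distr)
  define u0 where "u0 = (\<lambda>(x, y). \<Psi> (k * x + c * y))"
  define u1 where "u1 = (\<lambda>(x, y). \<Psi> (k * x + c * y) * s y)"
  define u2 where "u2 = (\<lambda>(x, y). deriv \<Psi> (k * x + c * y))"
  have [measurable]: "u0 \<in> borel_measurable (borel \<Otimes>\<^sub>M borel)" "u1 \<in> borel_measurable (borel \<Otimes>\<^sub>M borel)"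
     "u2 \<in> borel_measurable (borel \<Otimes>\<^sub>M borel)"
    unfolding u0_def u1_def u2_def by measurable
  have u_int: "integrable (G \<Otimes>\<^sub>M F) u0" "integrable (G \<Otimes>\<^sub>M F) u1" "integrable (G \<Otimes>\<^sub>M F) u2"
    using int by (simp_all add: trans) (simp_all add: u0_def u1_def u2_def)
  have "AE x in G. (LINT y|F. u1 (x, y)) = - c * (LINT y|F. u2 (x, y))"
    using GF.AE_integrable_fst'[OF u_int(1)] GF.AE_integrable_fst'[OF u_int(2)] GF.AE_integrable_fst'[OF u_int(3)]
  proof eventually_elim
    case (elim x)
    have "(LINT y|F. \<Psi> (k * x + c * y) * s y) = - (LINT y|F. c * deriv \<Psi> (k * x + c * y))"
    proof (rule score_integration_by_parts[where f = f])
      show "F = density lborel (\<lambda>x. ennreal (f x))" by (simp add: F_def Y)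
      have "\<bar>\<Psi> (k * x + c * v) - \<Psi> (k * x + c * u)\<bar> \<le> \<bar>c\<bar> * \<bar>v - u\<bar>" for u v
        using Psi_Lip[of "k * x + c * v" "k * x + c * u"] by (simp add: abs_mult[symmetric] algebra_simps)
      then show "\<forall>u v. abs_continuous_on {u..v} (\<lambda>y. \<Psi> (k * x + c * y))"
        by (intro allI abs_continuous_on_Lipschitz)
      show "AE y in lborel. ((\<lambda>y. \<Psi> (k * x + c * y)) has_real_derivative c * deriv \<Psi> (k * x + c * y)) (at y)"
        using AE_lborel_real_affine[OF Psi_diff c, of "k * x"]
      proof eventually_elim
        case (elim y)
        then have "(\<Psi> has_real_derivative deriv \<Psi> (k * x + c * y)) (at (k * x + c * y))"
          by (simp add: DERIV_deriv_iff_real_differentiable)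
        moreover have "((\<lambda>y. k * x + c * y) has_real_derivative c) (at y)"
          by (auto intro!: derivative_eq_intros)
        ultimately show ?case using DERIV_chain2 by (fastforce simp: mult.commute)
      qed
    qed (use elim f_nonneg f_ac f_deriv in \<open>simp_all add: u0_def u1_def u2_def\<close>)
    then show ?case by (simp add: u1_def u2_def)
  qed
  then have "(LINT x|G. (LINT y|F. u1 (x, y))) = (LINT x|G. - c * (LINT y|F. u2 (x, y)))"
    by (intro integral_cong_AE) measurable
  then have "(LINT z|(G \<Otimes>\<^sub>M F). u1 z) = - c * (LINT z|(G \<Otimes>\<^sub>M F). u2 z)"
    using GF.integral_fst'[OF u_int(2)] GF.integral_fst'[OF u_int(3)] by simp
  then show ?thesis by (simp add: trans) (simp add: u1_def u2_def)
qed

section \<open>The information bound\<close>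

lemma (in prob_space) indep_var_swap:
  assumes "indep_var S X T Y"
  shows "indep_var T Y S X"
proof -
  have swap: "indep_set B A" if AB: "indep_set A B" for A B
    unfolding indep_sets2_eq
    using indep_setD[OF AB] indep_setD_ev1[OF AB] indep_setD_ev2[OF AB]
    by (metis Int_commute mult.commute)
  show ?thesis using assms unfolding indep_var_eq by (blast intro: swap)
qed

text \<open>
  The Cramer-Rao inequality combined with Stam's inequality for a normal summand: for
  \<open>J > 0\<close> and \<open>E \<Psi>'(Y) \<noteq> 0\<close> it says that \<open>E \<Psi>(Y)\<^sup>2 / (E \<Psi>'(Y))\<^sup>2 \<ge> 1 / J + \<tau>\<^sup>2\<close>.  It is the Cauchy-Schwarz inequality for \<open>\<Psi>(Y)\<close> and a
  combination of the scores of \<open>W\<close> and \<open>\<tau> Z\<close>.  By integration by parts both scores have the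
  same covariance \<open>- E \<Psi>'(Y)\<close> with \<open>\<Psi>(Y)\<close>.  In the multiplied form \<open>J = 0\<close> is allowed and forces
  \<open>E \<Psi>'(Y) = 0\<close>.
\<close>

lemma (in prob_space) gaussian_convolution_information_bound:
  fixes f s \<Psi> :: "real \<Rightarrow> real" and W Z :: "'a \<Rightarrow> real"
  assumes f_nonneg: "\<And>x. 0 \<le> f x"
    and f_ac: "\<forall>u v. abs_continuous_on {u..v} f"
    and f_deriv: "AE x in lborel. (f has_real_derivative s x * f x) (at x)"
    and [measurable]: "f \<in> borel_measurable borel" "s \<in> borel_measurable borel" 
    and Psi_Lip: "\<And>x y. \<bar>\<Psi> y - \<Psi> x\<bar> \<le> \<bar>y - x\<bar>"
    and Psi_diff: "AE x in lborel. \<Psi> differentiable (at x)"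
    and ind: "indep_var borel W borel Z"
    and W: "distr M borel W = density lborel (\<lambda>x. ennreal (f x))"
    and Z: "distr M borel Z = density lborel (\<lambda>x. ennreal (std_normal_density x))"
    and \<tau>: "\<tau> > 0"
    and sq_int: "integrable M (\<lambda>\<omega>. (\<Psi> (W \<omega> + \<tau> * Z \<omega>))\<^sup>2)" 
    and deriv_int: "integrable M (\<lambda>\<omega>. deriv \<Psi> (W \<omega> + \<tau> * Z \<omega>))"
    and s_int: "integrable M (\<lambda>\<omega>. (s (W \<omega>))\<^sup>2)"
    and J: "J = expectation (\<lambda>\<omega>. (s (W \<omega>))\<^sup>2)"
  shows "(1 + J * \<tau>\<^sup>2) * (expectation (\<lambda>\<omega>. deriv \<Psi> (W \<omega> + \<tau> * Z \<omega>)))\<^sup>2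
     \<le> J * expectation (\<lambda>\<omega>. (\<Psi> (W \<omega> + \<tau> * Z \<omega>))\<^sup>2)"
proof -
  have rv [measurable]: "W \<in> borel_measurable M" "Z \<in> borel_measurable M"
    using indep_var_rv1[OF ind] indep_var_rv2[OF ind] by auto
  have ind': "indep_var borel Z borel W" by (rule indep_var_swap[OF ind])
  have [measurable]: "\<Psi> \<in> borel_measurable borel"
    using Psi_Lip by (intro borel_measurable_continuous_onI nonexpansive_continuous)
  have Z_dist: "distributed M lborel Z std_normal_density"
    using Z by (simp add: distributed_def distr_cong[of M M lborel borel Z Z])
  have Z_mean: "expectation Z = 0" and Z_sq: "expectation (\<lambda>\<omega>. (Z \<omega>)\<^sup>2) = 1"
      and Z_int: "integrable M Z" and Z_sq_int: "integrable M (\<lambda>\<omega>. (Z \<omega>)\<^sup>2)"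
  proof -
    have tr: "integrable M (\<lambda>\<omega>. h (Z \<omega>)) \<longleftrightarrow> integrable lborel (\<lambda>x. std_normal_density x * h x)"
       "expectation (\<lambda>\<omega>. h (Z \<omega>)) = (\<integral>x. std_normal_density x * h x \<partial>lborel)"
      if "h \<in> borel_measurable borel" for h :: "real \<Rightarrow> real"
      using distributed_integrable[OF Z_dist, of h] distributed_integral[OF Z_dist, of h] that by auto
    show "expectation Z = 0" "integrable M Z"
      using tr[of "\<lambda>x. x"] std_normal_moment_odd[of 0] by (simp_all add: has_bochner_integral_iff)
    show "expectation (\<lambda>\<omega>. (Z \<omega>)\<^sup>2) = 1" "integrable M (\<lambda>\<omega>. (Z \<omega>)\<^sup>2)"
      using tr[of "\<lambda>x. x\<^sup>2"] std_normal_moment_even[of 1] by (simp_all add: has_bochner_integral_iff)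
  qed
  let ?Y = "\<lambda>\<omega>. W \<omega> + \<tau> * Z \<omega>"
  define D where "D = expectation (\<lambda>\<omega>. deriv \<Psi> (?Y \<omega>))"
  have Psi_int: "integrable M (\<lambda>\<omega>. \<Psi> (?Y \<omega>))"
    by (rule square_integrable_imp_integrable[OF _ sq_int]) measurable
  have s_int1: "integrable M (\<lambda>\<omega>. s (W \<omega>))"
    by (rule square_integrable_imp_integrable[OF _ s_int]) measurable
  have PZ_int: "integrable M (\<lambda>\<omega>. \<Psi> (?Y \<omega>) * Z \<omega>)"
    using sq_int Z_sq_int by (intro integrable_mult_of_squares) auto
  have PS_int: "integrable M (\<lambda>\<omega>. \<Psi> (?Y \<omega>) * s (W \<omega>))"
    using sq_int s_int by (intro integrable_mult_of_squares) auto
  have "expectation (\<lambda>\<omega>. \<Psi> (\<tau> * Z \<omega> + 1 * W \<omega>) * s (W \<omega>))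
      = - 1 * expectation (\<lambda>\<omega>. deriv \<Psi> (\<tau> * Z \<omega> + 1 * W \<omega>))"
    using Psi_int PS_int deriv_int f_nonneg f_ac f_deriv Psi_Lip Psi_diff ind' W
    by (intro expectation_score_identity[where f = f]) (simp_all add: add.commute)
  then have PS: "expectation (\<lambda>\<omega>. \<Psi> (?Y \<omega>) * s (W \<omega>)) = - D"
    by (simp add: D_def add.commute)
  have "expectation (\<lambda>\<omega>. \<Psi> (1 * W \<omega> + \<tau> * Z \<omega>) * (- Z \<omega>))
      = - \<tau> * expectation (\<lambda>\<omega>. deriv \<Psi> (1 * W \<omega> + \<tau> * Z \<omega>))"
    using Psi_int PZ_int deriv_int Psi_Lip Psi_diff ind Z \<tau>
    by (intro expectation_score_identity[where f = std_normal_density and s = uminus])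
      (simp_all add: abs_continuous_std_normal_density std_normal_density_score[simplified])
  then have PZ: "expectation (\<lambda>\<omega>. \<Psi> (?Y \<omega>) * Z \<omega>) = \<tau> * D"
    by (simp add: D_def)
  have ind_s: "indep_var borel (\<lambda>\<omega>. s (W \<omega>)) borel Z"
  proof -
    have "indep_var borel (s \<circ> W) borel ((\<lambda>x. x) \<circ> Z)"
      by (rule indep_var_compose[OF ind]) measurable
    then show ?thesis by (simp add: comp_def)
  qed
  have sZ: "integrable M (\<lambda>\<omega>. s (W \<omega>) * Z \<omega>)" "expectation (\<lambda>\<omega>. s (W \<omega>) * Z \<omega>) = 0"
    using indep_var_integrable[OF ind_s s_int1 Z_int] indep_var_lebesgue_integral[OF ind_s s_int1 Z_int] Z_mean
    by simp_all
  \<comment> \<open>The linear combination of the scores of \<open>\<tau> Z\<close> and \<open>W\<close> with weights proportional to the variance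
    \<open>\<tau>\<^sup>2\<close> and to the inverse information \<open>1 / J\<close>, scaled by \<open>- J\<close>.  This ratio of the weights gives
    the best Cauchy-Schwarz bound.\<close>
  define u where "u \<omega> = J * \<tau> * Z \<omega> - s (W \<omega>)" for \<omega>
  have [measurable]: "u \<in> borel_measurable M" unfolding u_def by measurable
  have u_sq: "(u \<omega>)\<^sup>2 = (J * \<tau>)\<^sup>2 * (Z \<omega>)\<^sup>2 - 2 * (J * \<tau>) * (s (W \<omega>) * Z \<omega>) + (s (W \<omega>))\<^sup>2" for \<omega>
    by (simp add: u_def power2_eq_square algebra_simps)
  have u_int: "integrable M (\<lambda>\<omega>. (u \<omega>)\<^sup>2)" unfolding u_sq using Z_sq_int sZ s_int by simp
  have Eu: "expectation (\<lambda>\<omega>. (u \<omega>)\<^sup>2) = J * (1 + J * \<tau>\<^sup>2)"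
  proof -
    have "expectation (\<lambda>\<omega>. (u \<omega>)\<^sup>2) = (J * \<tau>)\<^sup>2 + J"
      unfolding u_sq using Z_sq_int sZ s_int Z_sq J[symmetric] by simp
    then show ?thesis by (simp add: power2_eq_square algebra_simps)
  qed
  have "(\<lambda>\<omega>. \<Psi> (?Y \<omega>) * u \<omega>) = (\<lambda>\<omega>. J * \<tau> * (\<Psi> (?Y \<omega>) * Z \<omega>) - \<Psi> (?Y \<omega>) * s (W \<omega>))"
    by (simp add: fun_eq_iff u_def algebra_simps)
  then have EPu: "expectation (\<lambda>\<omega>. \<Psi> (?Y \<omega>) * u \<omega>) = (1 + J * \<tau>\<^sup>2) * D"
    using PZ_int PS_int PZ PS by (simp add: power2_eq_square algebra_simps)
  have "J \<ge> 0" by (simp add: J)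
  then have pos: "1 + J * \<tau>\<^sup>2 > 0" by (simp add: add_pos_nonneg)
  have "((1 + J * \<tau>\<^sup>2) * D)\<^sup>2 \<le> expectation (\<lambda>\<omega>. (\<Psi> (?Y \<omega>))\<^sup>2) * (J * (1 + J * \<tau>\<^sup>2))"
    using Cauchy_Schwarz_integral[of "\<lambda>\<omega>. \<Psi> (?Y \<omega>)" M u] sq_int u_int unfolding EPu Eu by simp
  then have "(1 + J * \<tau>\<^sup>2) * ((1 + J * \<tau>\<^sup>2) * D\<^sup>2) \<le> (1 + J * \<tau>\<^sup>2) * (J * expectation (\<lambda>\<omega>. (\<Psi> (?Y \<omega>))\<^sup>2))"
    by (simp add: power2_eq_square mult_ac)
  then show ?thesis using pos unfolding D_def by (simp only: mult_le_cancel_left_pos)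
qed

theorem corollary4p3:
  fixes \<rho> :: "real \<Rightarrow> real" and \<delta> \<tau> b :: real
    and F\<^sub>W :: "real measure" and M :: "'a measure" and W Z :: "'a \<Rightarrow> real"
  assumes rho_nonneg: "\<forall>x. 0 \<le> \<rho> x"
    and rho_smooth: "smooth_loss \<rho>"
    and rho_strongly_convex: "strongly_convex_loss \<rho>"
    and delta: "\<delta> > 1"
    and F_dist: "real_distribution F\<^sub>W"
    and F_first_moment: "integrable F\<^sub>W (\<lambda>w. w)"
    and F_mean: "(LINT w|F\<^sub>W. w) = 0"
    and F_second_moment: "integrable F\<^sub>W (\<lambda>w. w\<^sup>2)"
    and F_fisher: "has_fisher_information F\<^sub>W"
    and M: "prob_space M"
    and W_rv: "W \<in> borel_measurable M"
    and W_law: "distr M borel W = F\<^sub>W"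
    and Z_rv: "Z \<in> borel_measurable M"
    and Z_law: "distr M borel Z = normal_distribution 0 1"
    and indep: "prob_space.indep_var M borel W borel Z"
    and tau: "\<tau> > 0" and b: "b > 0"
    and eq1: "\<tau>\<^sup>2 = \<delta> * (LINT \<omega>|M. (effective_score \<rho> b (W \<omega> + \<tau> * Z \<omega>))\<^sup>2)"
    and eq2: "1 / \<delta> = (LINT \<omega>|M. deriv (effective_score \<rho> b) (W \<omega> + \<tau> * Z \<omega>))"
  shows "ennreal (huber_variance (effective_score \<rho> b) (F\<^sub>W \<star> normal_distribution 0 \<tau>))
           \<ge> ennreal (1 / (1 - 1 / \<delta>)) * (1 / fisher_information F\<^sub>W)"
proof -
  interpret prob_space M by (rule M)
  note [measurable] = W_rv Z_rv
  let ?\<Psi> = "effective_score \<rho> b" and ?Y = "\<lambda>\<omega>. W \<omega> + \<tau> * Z \<omega>"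
  have Lip: "\<bar>?\<Psi> y - ?\<Psi> x\<bar> \<le> \<bar>y - x\<bar>" for x y
    using effective_score_regularity[OF rho_smooth rho_strongly_convex b] by auto
  have diff: "AE x in lborel. ?\<Psi> differentiable (at x)"
    using effective_score_regularity[OF rho_smooth rho_strongly_convex b] by auto
  have cont: "continuous_on UNIV ?\<Psi>" by (rule nonexpansive_continuous[OF Lip])
  have [measurable]: "?\<Psi> \<in> borel_measurable borel" "deriv ?\<Psi> \<in> borel_measurable borel"
    using cont by (auto intro: borel_measurable_continuous_onI borel_measurable_deriv)
  have Psi_sq: "expectation (\<lambda>\<omega>. (?\<Psi> (?Y \<omega>))\<^sup>2) = \<tau>\<^sup>2 / \<delta>"
    using eq1 delta by (simp add: field_simps)
  have Z_dist: "distributed M lborel Z std_normal_density"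
    using Z_law by (simp add: distributed_def normal_distribution_def distr_cong[of M M lborel borel Z Z])
  have "distr M borel (\<lambda>\<omega>. \<tau> * Z \<omega>) = normal_distribution 0 \<tau>"
    using normal_density_affine[OF Z_dist, of \<tau> 0] tau
    by (simp add: distributed_def normal_distribution_def
        distr_cong[of M M lborel borel "\<lambda>\<omega>. \<tau> * Z \<omega>" "\<lambda>\<omega>. \<tau> * Z \<omega>"])
  moreover have "indep_var borel W borel (\<lambda>\<omega>. \<tau> * Z \<omega>)"
    using indep_var_compose[OF indep, of "\<lambda>x. x" borel "\<lambda>x. \<tau> * x" borel] by (simp add: comp_def)
  ultimately have conv: "F\<^sub>W \<star> normal_distribution 0 \<tau> = distr M borel ?Y"
    using sum_indep_random_variable[of W "\<lambda>\<omega>. \<tau> * Z \<omega>"] W_law by simp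
  have "huber_variance ?\<Psi> (F\<^sub>W \<star> normal_distribution 0 \<tau>) = (\<tau>\<^sup>2 / \<delta>) / (1 / \<delta>)\<^sup>2"
    unfolding huber_variance_def conv by (simp add: integral_distr Psi_sq eq2[symmetric])
  also have "\<dots> = \<delta> * \<tau>\<^sup>2" using delta by (simp add: field_simps power2_eq_square)
  finally have V: "huber_variance ?\<Psi> (F\<^sub>W \<star> normal_distribution 0 \<tau>) = \<delta> * \<tau>\<^sup>2" .
  define f where "f = (SOME f. is_ac_density F\<^sub>W f)"
  have f: "is_ac_density F\<^sub>W f"
    using F_fisher unfolding has_fisher_information_def f_def by (rule someI_ex)
  define s where "s x = deriv f x / f x" for x
  note score = is_ac_density_score[OF f, folded s_def]
  note [measurable] = score(2,3)
  have info: "fisher_information F\<^sub>W = (\<integral>\<^sup>+ x. ennreal ((s x)\<^sup>2) \<partial>F\<^sub>W)"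
    unfolding fisher_information_def Let_def f_def[symmetric] score(5) ..
  also have "\<dots> = (\<integral>\<^sup>+ \<omega>. ennreal ((s (W \<omega>))\<^sup>2) \<partial>M)"
    unfolding W_law[symmetric] by (subst nn_integral_distr) auto
  finally have info: "fisher_information F\<^sub>W = (\<integral>\<^sup>+ \<omega>. ennreal ((s (W \<omega>))\<^sup>2) \<partial>M)" .
  show ?thesis
  proof (cases "fisher_information F\<^sub>W = \<infinity>")
    case True
    then show ?thesis by simp
  next
    case False
    then have s_int: "integrable M (\<lambda>\<omega>. (s (W \<omega>))\<^sup>2)"
      unfolding info by (intro integrableI_nonneg) (auto simp: top.not_eq_extremum)
    define J where "J = expectation (\<lambda>\<omega>. (s (W \<omega>))\<^sup>2)"
    have info_J: "fisher_information F\<^sub>W = ennreal J"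
      unfolding info J_def by (rule nn_integral_eq_integral[OF s_int]) simp
    have "(1 + J * \<tau>\<^sup>2) * (expectation (\<lambda>\<omega>. deriv ?\<Psi> (?Y \<omega>)))\<^sup>2 \<le> J * expectation (\<lambda>\<omega>. (?\<Psi> (?Y \<omega>))\<^sup>2)"
    proof (rule gaussian_convolution_information_bound[where f = f and s = s])
      \<comment> \<open>Integrals of nonintegrable functions are \<open>0\<close> by convention, whereas both equations
        prescribe nonzero values.\<close>
      show "integrable M (\<lambda>\<omega>. (?\<Psi> (?Y \<omega>))\<^sup>2)"
        using not_integrable_integral_eq[of M "\<lambda>\<omega>. (?\<Psi> (?Y \<omega>))\<^sup>2"] Psi_sq tau delta by auto
      show "integrable M (\<lambda>\<omega>. deriv ?\<Psi> (?Y \<omega>))"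
      proof (rule ccontr)
        assume "\<not> ?thesis"
        then have "1 / \<delta> = 0" using eq2 by (simp add: not_integrable_integral_eq)
        then show False using delta by simp
      qed
      show "distr M borel W = density lborel (\<lambda>x. ennreal (f x))" "\<And>x. 0 \<le> f x"
        using f W_law by (auto simp: is_ac_density_def)
      show "distr M borel Z = density lborel (\<lambda>x. ennreal (std_normal_density x))"
        using Z_law by (simp add: normal_distribution_def)
    qed (fact score Lip diff indep tau s_int J_def)+
    then have "(1 + J * \<tau>\<^sup>2) / \<delta>\<^sup>2 \<le> J * (\<tau>\<^sup>2 / \<delta>)"
      unfolding Psi_sq eq2[symmetric] by (simp add: power_divide)
    then have "1 + J * \<tau>\<^sup>2 \<le> J * (\<tau>\<^sup>2 / \<delta>) * \<delta>\<^sup>2"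
      using delta by (subst (asm) pos_divide_le_eq) auto
    also have "\<dots> = \<delta> * (J * \<tau>\<^sup>2)"
      using delta by (simp add: field_simps power2_eq_square)
    finally have "1 + J * \<tau>\<^sup>2 \<le> \<delta> * (J * \<tau>\<^sup>2)" .
    then have key: "1 \<le> (\<delta> - 1) * \<tau>\<^sup>2 * J" by (simp add: algebra_simps)
    have J: "J > 0"
    proof (rule ccontr)
      assume "\<not> J > 0"
      then have "(\<delta> - 1) * \<tau>\<^sup>2 * J \<le> 0" using delta by (intro mult_nonneg_nonpos) auto
      then show False using key by simp
    qed
    have "1 / (1 - 1 / \<delta>) * (1 / J) = \<delta> * (1 / ((\<delta> - 1) * J))"
      using J delta by (simp add: field_simps)
    also have "\<dots> \<le> \<delta> * \<tau>\<^sup>2"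
      using key J delta by (intro mult_left_mono) (simp_all add: pos_divide_le_eq mult_ac)
    finally have "1 / (1 - 1 / \<delta>) * (1 / J) \<le> \<delta> * \<tau>\<^sup>2" .
    then have "ennreal (1 / (1 - 1 / \<delta>) * (1 / J)) \<le> ennreal (\<delta> * \<tau>\<^sup>2)"
      by (rule ennreal_leI)
    moreover have "ennreal (1 / (1 - 1 / \<delta>)) * (1 / ennreal J) = ennreal (1 / (1 - 1 / \<delta>) * (1 / J))"
    proof -
      have inv: "1 / ennreal J = ennreal (1 / J)" using divide_ennreal[of 1 J] J by simp
      show ?thesis unfolding inv using J by (intro ennreal_mult''[symmetric]) simp
    qed
    ultimately show ?thesis unfolding V info_J by simp
  qed
qed
end
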